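(* Let $F$ be a perfect field, $v:F^*\to\mathbb{Z}$ a discrete valuation with ring $\mathcal{O}_v$ and residue field $\kappa(v)$, and $\pi$ a uniformizing parameter for $v$. Let $\partial^\pi_v:K^{\mathrm{MW}}_*(F)\to K^{\mathrm{MW}}_{*-1}(\kappa(v))$ be the residue morphism. For all $n\leq 0$, $m\in\mathbb{Z}$ and $u\in\mathcal{O}_v^*$: $$\partial^\pi_v(\langle\pi^mu\rangle\eta^{-n})=\langle\overline{u}\rangle\eta^{-n+1}\chi^{\mathrm{odd}}(m).$$ For all $n\geq 1$, $m_1,\dots,m_n\in\mathbb{Z}$ and $u_1,\dots,u_n\in\mathcal{O}_v^*$: \begin{align*} &\partial^\pi_v([\pi^{m_1}u_1,\dots,\pi^{m_n}u_n])=\\ &\sum_{l=0}^{n-1}\ \sum_{\substack{J\subset\{1,\dots,n\},\,|J|=l\\ J=\{j_1<\dots<j_l\}}}\Big((-1)^{\sum_{i=1}^l(n-l+i-j_i)}\prod_{k\in\{1,\dots,n\}\setminus J}m_k\Big)_\epsilon\,[\underbrace{-1,\dots,-1}_{n-1-l\text{ terms}},\overline{u_{j_1}},\dots,\overline{u_{j_l}}]\\ &+\sum_{p=1}^n\ \sum_{l=p}^n\ \sum_{\substack{J\subset\{1,\dots,n\},\,|J|=l\\ J=\{j_1<\dots<j_l\}}}\Big(\sum_{I\subset\{1,\dots,l\},\,|I|=p}\eta^p\,\chi^{\mathrm{odd}}\Big(\prod_{i\in I}m_{j_i}\times\prod_{k\in\{1,\dots,n\}\setminus J}m_k\Big)\Big)[\underbrace{-1,\dots,-1}_{n-1+p-l\text{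 terms}},\overline{u_{j_1}},\dots,\overline{u_{j_l}}]. \end{align*}
   Context: For a field $k$, $K^{\mathrm{MW}}_*(k)$ is the Milnor-Witt $K$-theory ring: the graded ring generated by $[a]$ in degree $1$ ($a\in k^*$) and $\eta$ in degree $-1$, with relations $[a][1-a]=0$ ($a\neq 0,1$), $[ab]=[a]+[b]+\eta[a][b]$, $\eta[a]=[a]\eta$, $\eta(\eta[-1]+2)=0$. Notation: $[a_1,\dots,a_n]=[a_1]\cdots[a_n]$ (equal to $1$ if $n=0$); $\langle a\rangle=1+\eta[a]\in K^{\mathrm{MW}}_0(k)$; $\epsilon=-\langle-1\rangle$; for $n\in\mathbb{N}_0$, $n_\epsilon=\sum_{i=1}^n\langle(-1)^{i-1}\rangle$ and $(-n)_\epsilon=\epsilon\,n_\epsilon$; $\chi^{\mathrm{odd}}:\mathbb{Z}\to\{0,1\}$ is the characteristic function of the set of odd numbers. For $u\in\mathcal{O}_v^*$, $\overline{u}$ is its class in $\kappa(v)^*$. The residue morphism $\partial^\pi_v:K^{\mathrm{MW}}_*(F)\to K^{\mathrm{MW}}_{*-1}(\kappa(v))$ (due to Morel) is the only morphism of graded groups which commutes with multiplication by $\eta$ and satisfies, for all $n\in\mathbb{N}_0$ and $u_1,\dots,u_n\in\mathcal{O}_v^*$, $\partial^\pi_v([\pi,u_1,\dots,u_n])=[\overline{u_1},\dots,\overline{u_n}]$ and $\partial^\pi_v([u_1,\dots,u_n])=0$ (for $n=0$: $\partial^\pi_v([\pi])=1$, $\partial^\pi_v(1)=0$). *)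

theory Defs
  imports "HOL-Algebra.Algebra" "HOL-Library.Poly_Mapping"
begin

text \<open>Words form the free monoid, written additively so that the convolution product on
  \<open>'g word \<Rightarrow>\<^sub>0 int\<close> is the product of the noncommutative polynomial ring over \<open>\<int>\<close>.\<close>

datatype 'g word = Word (letters: "'g list")

instantiation word :: (type) monoid_add
begin

definition zero_word :: "'a word"
  where "0 = Word []"

definition plus_word :: "'a word \<Rightarrow> 'a word \<Rightarrow> 'a word"
  where "x + y = Word (letters x @ letters y)"

instance
  by standard (simp_all add: zero_word_def plus_word_def)

end

definition free_ring :: "'g set \<Rightarrow> ('g word \<Rightarrow>\<^sub>0 int) ring"
  where "free_ring S =
    \<lparr>carrier = {p. \<forall>w\<in>Poly_Mapping.keys p. set (letters w) \<subseteq> S},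
     monoid.mult = (*), one = 1, ring.zero = 0, ring.add = (+)\<rparr>"

definition letter :: "'g \<Rightarrow> 'g word \<Rightarrow>\<^sub>0 int"
  where "letter g = Poly_Mapping.single (Word [g]) 1"

datatype 'a mw_gen = Sym 'a | Eta

definition mw_gens :: "('a, 'b) ring_scheme \<Rightarrow> 'a mw_gen set"
  where "mw_gens F = insert Eta (Sym ` (carrier F - {\<zero>\<^bsub>F\<^esub>}))"

abbreviation mw_free :: "('a, 'b) ring_scheme \<Rightarrow> ('a mw_gen word \<Rightarrow>\<^sub>0 int) ring"
  where "mw_free F \<equiv> free_ring (mw_gens F)"

definition mw_relations :: "('a, 'b) ring_scheme \<Rightarrow> ('a mw_gen word \<Rightarrow>\<^sub>0 int) set"
  where "mw_relations F =
      {letter (Sym a) * letter (Sym (\<one>\<^bsub>F\<^esub> \<ominus>\<^bsub>F\<^esub> a)) | a.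
         a \<in> carrier F - {\<zero>\<^bsub>F\<^esub>, \<one>\<^bsub>F\<^esub>}}
    \<union> {letter (Sym (a \<otimes>\<^bsub>F\<^esub> b)) -
         (letter (Sym a) + letter (Sym b) + letter Eta * letter (Sym a) * letter (Sym b)) | a b.
         a \<in> carrier F - {\<zero>\<^bsub>F\<^esub>} \<and> b \<in> carrier F - {\<zero>\<^bsub>F\<^esub>}}
    \<union> {letter Eta * letter (Sym a) - letter (Sym a) * letter Eta | a.
         a \<in> carrier F - {\<zero>\<^bsub>F\<^esub>}}
    \<union> {letter Eta * (letter Eta * letter (Sym (\<ominus>\<^bsub>F\<^esub> \<one>\<^bsub>F\<^esub>)) + 2)}"

definition mw_ideal :: "('a, 'b) ring_scheme \<Rightarrow> ('a mw_gen word \<Rightarrow>\<^sub>0 int) set"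
  where "mw_ideal F = Idl\<^bsub>mw_free F\<^esub> (mw_relations F)"

definition KMW :: "('a, 'b) ring_scheme \<Rightarrow> ('a mw_gen word \<Rightarrow>\<^sub>0 int) set ring"
  where "KMW F = mw_free F Quot mw_ideal F"

definition mw_class ::
    "('a, 'b) ring_scheme \<Rightarrow> ('a mw_gen word \<Rightarrow>\<^sub>0 int) \<Rightarrow> ('a mw_gen word \<Rightarrow>\<^sub>0 int) set"
  where "mw_class F p = mw_ideal F +>\<^bsub>mw_free F\<^esub> p"

fun gen_degree :: "'a mw_gen \<Rightarrow> int"
  where "gen_degree (Sym a) = 1"
  | "gen_degree Eta = -1"

definition word_degree :: "'a mw_gen word \<Rightarrow> int"
  where "word_degree w = sum_list (map gen_degree (letters w))"

definition KMW_deg :: "('a, 'b) ring_scheme \<Rightarrow> int \<Rightarrow> ('a mw_gen word \<Rightarrow>\<^sub>0 int) set set"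
  where "KMW_deg F n =
    mw_class F ` {p \<in> carrier (mw_free F). \<forall>w\<in>Poly_Mapping.keys p. word_degree w = n}"

definition mw_eta :: "('a, 'b) ring_scheme \<Rightarrow> ('a mw_gen word \<Rightarrow>\<^sub>0 int) set"
  where "mw_eta F = mw_class F (letter Eta)"

definition mw_sym :: "('a, 'b) ring_scheme \<Rightarrow> 'a list \<Rightarrow> ('a mw_gen word \<Rightarrow>\<^sub>0 int) set"
  where "mw_sym F as =
    foldr (\<lambda>a x. mw_class F (letter (Sym a)) \<otimes>\<^bsub>KMW F\<^esub> x) as \<one>\<^bsub>KMW F\<^esub>"

definition mw_angle :: "('a, 'b) ring_scheme \<Rightarrow> 'a \<Rightarrow> ('a mw_gen word \<Rightarrow>\<^sub>0 int) set"
  where "mw_angle F a = \<one>\<^bsub>KMW F\<^esub> \<oplus>\<^bsub>KMW F\<^esub> mw_eta F \<otimes>\<^bsub>KMW F\<^esub> mw_sym F [a]"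

definition mw_epsilon :: "('a, 'b) ring_scheme \<Rightarrow> ('a mw_gen word \<Rightarrow>\<^sub>0 int) set"
  where "mw_epsilon F = \<ominus>\<^bsub>KMW F\<^esub> mw_angle F (\<ominus>\<^bsub>F\<^esub> \<one>\<^bsub>F\<^esub>)"

definition mw_nat_eps :: "('a, 'b) ring_scheme \<Rightarrow> nat \<Rightarrow> ('a mw_gen word \<Rightarrow>\<^sub>0 int) set"
  where "mw_nat_eps F n =
    (\<Oplus>\<^bsub>KMW F\<^esub> i\<in>{1..n}. mw_angle F ((\<ominus>\<^bsub>F\<^esub> \<one>\<^bsub>F\<^esub>) [^]\<^bsub>F\<^esub> (i - 1)))"

definition mw_int_eps :: "('a, 'b) ring_scheme \<Rightarrow> int \<Rightarrow> ('a mw_gen word \<Rightarrow>\<^sub>0 int) set"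
  where "mw_int_eps F k =
    (if k \<ge> 0 then mw_nat_eps F (nat k)
     else mw_epsilon F \<otimes>\<^bsub>KMW F\<^esub> mw_nat_eps F (nat (- k)))"

definition chi_odd :: "int \<Rightarrow> int"
  where "chi_odd k = (if odd k then 1 else 0)"

definition perfect_field :: "('a, 'b) ring_scheme \<Rightarrow> bool"
  where "perfect_field F \<longleftrightarrow> field F \<and>
    (\<forall>p::nat. Factorial_Ring.prime p \<and> [p] \<cdot>\<^bsub>F\<^esub> \<one>\<^bsub>F\<^esub> = \<zero>\<^bsub>F\<^esub> \<longrightarrow>
       (\<forall>x\<in>carrier F. \<exists>y\<in>carrier F. y [^]\<^bsub>F\<^esub> p = x))"

text \<open>Valuations are normalised, i.e. onto \<open>\<int>\<close>; the value \<open>v \<zero>\<close> is irrelevant.\<close>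

definition discrete_valuation :: "('a, 'b) ring_scheme \<Rightarrow> ('a \<Rightarrow> int) \<Rightarrow> bool"
  where "discrete_valuation F v \<longleftrightarrow>
    v \<in> epi (units_of F) integer_group \<and>
    (\<forall>x\<in>Units F. \<forall>y\<in>Units F. x \<oplus>\<^bsub>F\<^esub> y \<in> Units F \<longrightarrow>
       v (x \<oplus>\<^bsub>F\<^esub> y) \<ge> min (v x) (v y))"

definition uniformizer :: "('a, 'b) ring_scheme \<Rightarrow> ('a \<Rightarrow> int) \<Rightarrow> 'a \<Rightarrow> bool"
  where "uniformizer F v \<pi> \<longleftrightarrow> \<pi> \<in> Units F \<and> v \<pi> = 1"

definition valuation_ring :: "('a, 'b) ring_scheme \<Rightarrow> ('a \<Rightarrow> int) \<Rightarrow> ('a, 'b) ring_scheme"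
  where "valuation_ring F v = F\<lparr>carrier := {x \<in> carrier F. x = \<zero>\<^bsub>F\<^esub> \<or> v x \<ge> 0}\<rparr>"

definition valuation_ideal :: "('a, 'b) ring_scheme \<Rightarrow> ('a \<Rightarrow> int) \<Rightarrow> 'a set"
  where "valuation_ideal F v = {x \<in> carrier F. x = \<zero>\<^bsub>F\<^esub> \<or> v x > 0}"

definition residue_field :: "('a, 'b) ring_scheme \<Rightarrow> ('a \<Rightarrow> int) \<Rightarrow> 'a set ring"
  where "residue_field F v = valuation_ring F v Quot valuation_ideal F v"

definition residue_class :: "('a, 'b) ring_scheme \<Rightarrow> ('a \<Rightarrow> int) \<Rightarrow> 'a \<Rightarrow> 'a set"
  where "residue_class F v u = valuation_ideal F v +>\<^bsub>valuation_ring F v\<^esub> u"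

text \<open>A morphism of graded groups is given by an additive map on the direct sum of the
  components.  Morel shows that exactly one map on the carrier satisfies these conditions; the
  case \<open>us = []\<close> covers \<open>[\<pi>] \<mapsto> 1\<close> and \<open>1 \<mapsto> 0\<close>.\<close>

definition is_residue_morphism ::
    "('a, 'b) ring_scheme \<Rightarrow> ('a \<Rightarrow> int) \<Rightarrow> 'a \<Rightarrow>
     (('a mw_gen word \<Rightarrow>\<^sub>0 int) set \<Rightarrow> ('a set mw_gen word \<Rightarrow>\<^sub>0 int) set) \<Rightarrow> bool"
  where "is_residue_morphism F v \<pi> \<delta> \<longleftrightarrow>
    \<delta> \<in> hom (add_monoid (KMW F)) (add_monoid (KMW (residue_field F v))) \<and>
    (\<forall>n. \<delta> ` KMW_deg F n \<subseteq> KMW_deg (residue_field F v) (n - 1)) \<and>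
    (\<forall>x\<in>carrier (KMW F).
       \<delta> (mw_eta F \<otimes>\<^bsub>KMW F\<^esub> x) =
       mw_eta (residue_field F v) \<otimes>\<^bsub>KMW (residue_field F v)\<^esub> \<delta> x) \<and>
    (\<forall>us. set us \<subseteq> Units (valuation_ring F v) \<longrightarrow>
       \<delta> (mw_sym F (\<pi> # us)) = mw_sym (residue_field F v) (map (residue_class F v) us) \<and>
       \<delta> (mw_sym F us) = \<zero>\<^bsub>KMW (residue_field F v)\<^esub>)"

text \<open>For \<open>J = {j\<^sub>1 < \<dots> < j\<^sub>l}\<close> and \<open>1 \<le> i \<le> l\<close>, \<open>nth_elem J i\<close> is \<open>j\<^sub>i\<close>.
  If \<open>J \<subseteq> {1..n}\<close>, then \<open>j\<^sub>i \<le> n - l + i\<close>, since the \<open>l - i\<close> larger elements of \<open>J\<close> are at most \<open>n\<close>;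
  so \<open>n - l + i - nth_elem J i\<close> on \<open>nat\<close> does not truncate.\<close>

definition nth_elem :: "nat set \<Rightarrow> nat \<Rightarrow> nat"
  where "nth_elem J i = sorted_list_of_set J ! (i - 1)"

text \<open>\<open>[-1, \<dots>, -1, u(j\<^sub>1), \<dots>, u(j\<^sub>l)]\<close> with \<open>r\<close> entries \<open>-1\<close>.\<close>

definition mw_sym_minus_one ::
    "('a, 'b) ring_scheme \<Rightarrow> nat \<Rightarrow> (nat \<Rightarrow> 'a) \<Rightarrow> nat set \<Rightarrow> ('a mw_gen word \<Rightarrow>\<^sub>0 int) set"
  where "mw_sym_minus_one F r u J =
    mw_sym F (replicate r (\<ominus>\<^bsub>F\<^esub> \<one>\<^bsub>F\<^esub>) @ map u (sorted_list_of_set J))"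

end

theory Submission
  imports Defs
begin

text \<open>The residue morphism is known on symbols whose entries are units except for at most one leading
  \<open>[\<pi>]\<close>, so the formula follows once a product of symbols \<open>[\<pi>\<^sup>m u]\<close> is rewritten as a combination of
  such symbols with coefficients that \<open>\<delta>\<close> respects.

  Four identities in \<open>K\<^sup>M\<^sup>W(F)\<close> do this. Put \<open>h = 1 + \<langle>-1\<rangle>\<close>. Then \<open>\<eta>h = 0\<close>, \<open>h\<close> commutes with all symbols and
  \<open>hh = 2h\<close>; hence \<open>k\<^sub>\<epsilon> = (k div 2)h + (k mod 2)\<close> for every integer \<open>k\<close>, these elements multiply like the
  integers (\<open>eps_mult\<close>), and \<open>\<eta>k\<^sub>\<epsilon>\<close> depends only on the parity of \<open>k\<close> (\<open>eps_eta\<close>), which is where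
  \<open>\<chi>\<^sup>o\<^sup>d\<^sup>d\<close> comes from. Next, \<open>[a][-a] = 0\<close> gives \<open>[\<pi>][\<pi>] = [\<pi>][-1]\<close> (\<open>sym_square\<close>), the source of the entries
  \<open>-1\<close>, and \<open>[u][\<pi>] = \<epsilon>[\<pi>][u]\<close> (\<open>sym_anticommute\<close>), the source of the signs. Finally
  \<open>[\<pi>\<^sup>m] = m\<^sub>\<epsilon>[\<pi>]\<close> for all integers \<open>m\<close> (\<open>sym_int_pow\<close>).

  Therefore \<open>[\<pi>\<^sup>m u] = m\<^sub>\<epsilon>[\<pi>] + [u] + \<eta> m\<^sub>\<epsilon>[\<pi>][u]\<close>. Expanding a product of \<open>n\<close> such sums means choosing one
  of the three summands in each factor: let \<open>J\<close> be the set of positions where \<open>[u]\<close> occurs and \<open>I \<subseteq> J\<close>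
  the set of those where the summand with \<open>\<eta>\<close> is taken. The choice \<open>(I, J)\<close> contributes a multiple of
  \<open>\<eta>\<^sup>p[\<pi>]\<^sup>r\<close> times the symbol of the \<open>u\<^sub>j\<close>, where \<open>p = |I|\<close> and \<open>r = n - |J| + |I|\<close>
  (\<open>mw_sym_expansion\<close>). Applying \<open>\<delta>\<close> turns \<open>[\<pi>]\<^sup>r\<close> into \<open>[-1]\<^sup>r\<^sup>-\<^sup>1\<close> and kills the single term with \<open>r = 0\<close>,
  that is \<open>I = {}\<close> and \<open>J = {1..n}\<close>. The terms with \<open>I = {}\<close> form the first sum of the formula and the
  others, sorted by \<open>|I|\<close>, \<open>|J|\<close> and \<open>J\<close>, the second (\<open>delta_mw_sym\<close>). The formula for
  \<open>\<langle>\<pi>\<^sup>m u\<rangle>\<eta>\<^sup>e\<close> is the case of a single factor, multiplied by a power of \<open>\<eta>\<close> (\<open>delta_mw_angle\<close>).\<close>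

section \<open>Milnor-Witt K-theory as a ring\<close>

lemma ring_free_ring: "ring (free_ring S)"
proof (rule ringI)
  show "abelian_group (free_ring S)"
  proof (rule abelian_groupI)
    fix x y assume "x \<in> carrier (free_ring S)" "y \<in> carrier (free_ring S)"
    then show "x \<oplus>\<^bsub>free_ring S\<^esub> y \<in> carrier (free_ring S)"
      using keys_add[of x y] by (auto simp: free_ring_def)
  next
    fix x assume "x \<in> carrier (free_ring S)"
    then have "- x \<in> carrier (free_ring S)" by (auto simp: free_ring_def)
    then show "\<exists>y\<in>carrier (free_ring S). y \<oplus>\<^bsub>free_ring S\<^esub> x = \<zero>\<^bsub>free_ring S\<^esub>"
      by (rule bexI[rotated]) (simp add: free_ring_def)
  qed (auto simp: free_ring_def algebra_simps)
  show "Group.monoid (free_ring S)"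
  proof (rule monoidI)
    fix x y assume "x \<in> carrier (free_ring S)" "y \<in> carrier (free_ring S)"
    then show "x \<otimes>\<^bsub>free_ring S\<^esub> y \<in> carrier (free_ring S)"
      using keys_mult[of x y] by (fastforce simp: free_ring_def plus_word_def)
  qed (auto simp: free_ring_def algebra_simps zero_word_def)
qed (auto simp: free_ring_def algebra_simps)

lemma free_ring_uminus:
  assumes "x \<in> carrier (free_ring S)"
  shows "\<ominus>\<^bsub>free_ring S\<^esub> x = - x"
proof -
  interpret ring "free_ring S" by (rule ring_free_ring)
  have "- x \<in> carrier (free_ring S)" using assms by (auto simp: free_ring_def)
  then show ?thesis
    using assms by (intro minus_equality) (auto simp: free_ring_def)
qed

lemma letter_in_free_ring: "letter g \<in> carrier (free_ring S) \<longleftrightarrow> g \<in> S"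
  by (auto simp: free_ring_def letter_def)


text \<open>The ideal generated by a set is an ideal only if the set lies in the carrier, here the free ring on
  the nonzero elements. In the relation for \<open>[ab]\<close> the product \<open>ab\<close> has to be nonzero, so \<open>R\<close> must be
  a domain.\<close>

lemma (in domain) mw_relations_closed: "mw_relations R \<subseteq> carrier (mw_free R)"
proof -
  interpret P: ring "mw_free R" by (rule ring_free_ring)
  have add: "p + q \<in> carrier (mw_free R)" and mult: "p * q \<in> carrier (mw_free R)"
    and diff: "p - q \<in> carrier (mw_free R)"
    if "p \<in> carrier (mw_free R)" "q \<in> carrier (mw_free R)" for p q
    using P.a_closed[OF that] P.m_closed[OF that] P.minus_closed[OF that] free_ring_uminus[OF that(2)]
    by (auto simp: a_minus_def free_ring_def)
  have two: "2 \<in> carrier (mw_free R)"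
    using add[OF P.one_closed P.one_closed] by (simp add: free_ring_def)
  have sym: "letter (Sym a) \<in> carrier (mw_free R)" if "a \<in> carrier R" "a \<noteq> \<zero>" for a
    using that by (auto simp: letter_in_free_ring mw_gens_def)
  have eta: "letter Eta \<in> carrier (mw_free R)"
    by (auto simp: letter_in_free_ring mw_gens_def)
  have "\<ominus> \<one> \<noteq> \<zero>" using one_not_zero by (metis add.inv_eq_1_iff one_closed)
  moreover have "\<one> \<ominus> a \<noteq> \<zero>" if "a \<in> carrier R" "a \<noteq> \<one>" for a
    using that by simp
  moreover have "a \<otimes> b \<noteq> \<zero>" if "a \<in> carrier R" "b \<in> carrier R" "a \<noteq> \<zero>" "b \<noteq> \<zero>" for a b
    using that integral by blast
  ultimately show ?thesis
    unfolding mw_relations_def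
    by (auto intro!: add mult diff two sym eta simp del: r_right_minus_eq)
qed

lemma free_ring_one: "\<one>\<^bsub>free_ring S\<^esub> = 1"
  by (simp add: free_ring_def)

text \<open>The ring \<open>R\<close> is a parameter so that unadorned ring notation refers to Milnor-Witt K-theory and two
  instances, for a field and for its residue field, can be used side by side.\<close>

locale milnor_witt = F: domain F + ring R
  for F :: "('a, 'b) ring_scheme" and R :: "('a mw_gen word \<Rightarrow>\<^sub>0 int) set ring" (structure) +
  assumes R_def: "R = KMW F"

lemma (in domain) milnor_witt_KMW: "milnor_witt R (KMW R)"
proof -
  interpret P: ring "mw_free R" by (rule ring_free_ring)
  have "ideal (mw_ideal R) (mw_free R)"
    unfolding mw_ideal_def by (rule P.genideal_ideal[OF mw_relations_closed])
  then show ?thesis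
    unfolding milnor_witt_def milnor_witt_axioms_def KMW_def
    by (auto intro: domain_axioms ideal.quotient_is_ring)
qed

context milnor_witt
begin

abbreviation sym :: "'a \<Rightarrow> _" where "sym a \<equiv> mw_class F (letter (Sym a))"
abbreviation eta ("\<eta>") where "\<eta> \<equiv> mw_eta F"
abbreviation neg_one where "neg_one \<equiv> \<ominus>\<^bsub>F\<^esub> \<one>\<^bsub>F\<^esub>"
abbreviation F_star where "F_star \<equiv> carrier F - {\<zero>\<^bsub>F\<^esub>}"

lemma ideal_mw_ideal: "ideal (mw_ideal F) (mw_free F)"
  unfolding mw_ideal_def
  by (rule ring.genideal_ideal[OF ring_free_ring F.mw_relations_closed])

lemma mw_class_hom: "mw_class F \<in> ring_hom (mw_free F) R"
  using ideal.rcos_ring_hom[OF ideal_mw_ideal] unfolding R_def KMW_def mw_class_def[abs_def] .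

lemma mw_class_simps:
  assumes "p \<in> carrier (mw_free F)" "q \<in> carrier (mw_free F)"
  shows "mw_class F p \<in> carrier R" "mw_class F (p + q) = mw_class F p \<oplus> mw_class F q"
    "mw_class F (p * q) = mw_class F p \<otimes> mw_class F q"
    "p + q \<in> carrier (mw_free F)" "p * q \<in> carrier (mw_free F)"
    "mw_class F (p - q) = mw_class F p \<ominus> mw_class F q"
    "p - q \<in> carrier (mw_free F)"
proof -
  interpret P: ring "mw_free F" by (rule ring_free_ring)
  interpret H: ring_hom_ring "mw_free F" R "mw_class F"
    by (rule ring_hom_ringI2) (auto intro: mw_class_hom ring_axioms P.ring_axioms)
  show "mw_class F p \<in> carrier R" using assms by simp
  show "mw_class F (p + q) = mw_class F p \<oplus> mw_class F q"
    using H.hom_add[OF assms] by (simp add: free_ring_def)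
  show "mw_class F (p * q) = mw_class F p \<otimes> mw_class F q"
    using H.hom_mult[OF assms] by (simp add: free_ring_def)
  show "p + q \<in> carrier (mw_free F)" "p * q \<in> carrier (mw_free F)"
    using P.a_closed[OF assms] P.m_closed[OF assms] by (auto simp: free_ring_def)
  have eq: "p - q = p \<ominus>\<^bsub>mw_free F\<^esub> q"
    using free_ring_uminus[OF assms(2)] by (simp add: a_minus_def) (simp add: free_ring_def)
  show "mw_class F (p - q) = mw_class F p \<ominus> mw_class F q" "p - q \<in> carrier (mw_free F)"
    using assms unfolding eq by (auto simp: a_minus_def)
qed

lemma mw_class_relation:
  assumes "p \<in> mw_relations F" shows "mw_class F p = \<zero>"
proof -
  interpret P: ring "mw_free F" by (rule ring_free_ring)
  interpret ideal "mw_ideal F" "mw_free F" by (rule ideal_mw_ideal)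
  have "p \<in> mw_ideal F"
    unfolding mw_ideal_def using P.genideal_self[OF F.mw_relations_closed] assms by blast
  then show ?thesis
    unfolding mw_class_def R_def KMW_def by (simp add: a_rcos_const FactRing_def)
qed

lemma letter_closed:
  "letter Eta \<in> carrier (mw_free F)"
  "a \<in> F_star \<Longrightarrow> letter (Sym a) \<in> carrier (mw_free F)"
  by (auto simp: letter_in_free_ring mw_gens_def)

lemma eta_closed [simp]: "\<eta> \<in> carrier R"
  unfolding mw_eta_def by (rule mw_class_simps(1)[OF letter_closed(1) letter_closed(1)])

lemma sym_closed [simp]: "a \<in> F_star \<Longrightarrow> sym a \<in> carrier R"
  by (rule mw_class_simps(1)[OF letter_closed(2) letter_closed(2)])

lemma neg_one_F_star [simp]: "neg_one \<in> F_star" "\<one>\<^bsub>F\<^esub> \<in> F_star"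
  using F.one_not_zero by (auto simp: F.add.inv_eq_1_iff)

lemma mult_F_star [simp]: "a \<in> F_star \<Longrightarrow> b \<in> F_star \<Longrightarrow> a \<otimes>\<^bsub>F\<^esub> b \<in> F_star"
  using F.integral by auto

lemma neg_F_star [simp]: "a \<in> F_star \<Longrightarrow> \<ominus>\<^bsub>F\<^esub> a \<in> F_star"
  by (auto simp: F.add.inv_eq_1_iff)

lemma eta_sym:
  assumes "a \<in> F_star" shows "\<eta> \<otimes> sym a = sym a \<otimes> \<eta>"
proof -
  have "letter Eta * letter (Sym a) - letter (Sym a) * letter Eta \<in> mw_relations F"
    using assms by (auto simp: mw_relations_def)
  from mw_class_relation[OF this] assms
  have "\<eta> \<otimes> sym a \<ominus> sym a \<otimes> \<eta> = \<zero>"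
    by (simp add: mw_class_simps letter_closed mw_eta_def)
  then show ?thesis using assms by simp
qed

lemma sym_mult:
  assumes "a \<in> F_star" "b \<in> F_star"
  shows "sym (a \<otimes>\<^bsub>F\<^esub> b) = sym a \<oplus> sym b \<oplus> \<eta> \<otimes> sym a \<otimes> sym b"
proof -
  have "letter (Sym (a \<otimes>\<^bsub>F\<^esub> b)) - (letter (Sym a) + letter (Sym b) +
      letter Eta * letter (Sym a) * letter (Sym b)) \<in> mw_relations F"
    using assms by (auto simp: mw_relations_def)
  from mw_class_relation[OF this] assms mult_F_star[OF assms]
  have "sym (a \<otimes>\<^bsub>F\<^esub> b) \<ominus> (sym a \<oplus> sym b \<oplus> \<eta> \<otimes> sym a \<otimes> sym b) = \<zero>"
    by (simp add: mw_class_simps letter_closed mw_eta_def del: Diff_iff r_right_minus_eq)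
  then show ?thesis using assms mult_F_star[OF assms] by (simp del: Diff_iff mult_F_star)
qed

lemma sym_steinberg:
  assumes "a \<in> F_star" "a \<noteq> \<one>\<^bsub>F\<^esub>"
  shows "sym a \<otimes> sym (\<one>\<^bsub>F\<^esub> \<ominus>\<^bsub>F\<^esub> a) = \<zero>"
proof -
  have *: "\<one>\<^bsub>F\<^esub> \<ominus>\<^bsub>F\<^esub> a \<in> F_star" using assms by auto
  have "letter (Sym a) * letter (Sym (\<one>\<^bsub>F\<^esub> \<ominus>\<^bsub>F\<^esub> a)) \<in> mw_relations F"
    using assms by (auto simp: mw_relations_def)
  from mw_class_relation[OF this] assms(1) * show ?thesis
    by (simp add: mw_class_simps letter_closed mw_eta_def del: Diff_iff)
qed

section \<open>The hyperbolic element and anticommutativity\<close>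

text \<open>The element \<open>h = 1 + \<langle>-1\<rangle>\<close>, the hyperbolic plane under the identification of degree \<open>0\<close> with
  the Grothendieck-Witt ring.\<close>

definition hyperbolic where "hyperbolic = \<one> \<oplus> \<one> \<oplus> \<eta> \<otimes> sym neg_one"

lemma hyperbolic_closed [simp]: "hyperbolic \<in> carrier R"
  unfolding hyperbolic_def using neg_one_F_star by (simp del: Diff_iff)

lemma eta_hyperbolic: "\<eta> \<otimes> hyperbolic = \<zero>"
proof -
  let ?n = "letter (Sym neg_one) :: 'a mw_gen word \<Rightarrow>\<^sub>0 int" and ?e = "letter Eta :: 'a mw_gen word \<Rightarrow>\<^sub>0 int"
  interpret P: ring "mw_free F" by (rule ring_free_ring)
  have one: "1 \<in> carrier (mw_free F)" "mw_class F 1 = \<one>"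
    using P.one_closed ring_hom_one[OF mw_class_hom] by (simp_all add: free_ring_one)
  note n = letter_closed(2)[OF neg_one_F_star(1)]
  note e = letter_closed(1)
  have c: "sym neg_one \<in> carrier R" "\<eta> \<in> carrier R"
    by (rule sym_closed[OF neg_one_F_star(1)], rule eta_closed)
  have "?e * (?e * ?n + (1 + 1)) \<in> mw_relations F"
    by (auto simp: mw_relations_def)
  then have "\<zero> = mw_class F (?e * (?e * ?n + (1 + 1)))"
    using mw_class_relation by metis
  also have "\<dots> = \<eta> \<otimes> (\<eta> \<otimes> sym neg_one \<oplus> (\<one> \<oplus> \<one>))"
    unfolding mw_eta_def one(2)[symmetric]
    by (simp only: mw_class_simps(2,3)[OF _ _] mw_class_simps(4,5)[OF _ _] n e one(1))
  also have "\<dots> = \<eta> \<otimes> hyperbolic"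
    unfolding hyperbolic_def using c by algebra
  finally show ?thesis by simp
qed


text \<open>The last term of the relation for \<open>[ab]\<close> is the only one not visibly symmetric in \<open>a\<close> and \<open>b\<close>. So
  symbols commute as soon as a factor \<open>\<eta>\<close> is present; this replaces anticommutativity in the presence of \<open>\<eta>\<close>.\<close>

lemma eta_swap:
  assumes "a \<in> F_star" "b \<in> F_star"
  shows "\<eta> \<otimes> (sym a \<otimes> sym b) = \<eta> \<otimes> (sym b \<otimes> sym a)"
proof -
  have c: "sym a \<in> carrier R" "sym b \<in> carrier R" "\<eta> \<in> carrier R" using assms sym_closed by simp_all
  have "a \<otimes>\<^bsub>F\<^esub> b = b \<otimes>\<^bsub>F\<^esub> a" using assms F.m_comm by simp
  then have *: "sym a \<oplus> sym b \<oplus> \<eta> \<otimes> sym a \<otimes> sym b = sym b \<oplus> sym a \<oplus> \<eta> \<otimes> sym b \<otimes> sym a"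
    using sym_mult[OF assms] sym_mult[OF assms(2,1)] by simp
  have "\<eta> \<otimes> (sym a \<otimes> sym b) = (sym a \<oplus> sym b \<oplus> \<eta> \<otimes> sym a \<otimes> sym b) \<ominus> sym a \<ominus> sym b"
    using c by algebra
  also have "\<dots> = \<eta> \<otimes> (sym b \<otimes> sym a)" unfolding * using c by algebra
  finally show ?thesis .
qed

lemma hyperbolic_sym:
  assumes "a \<in> F_star" shows "hyperbolic \<otimes> sym a = sym a \<otimes> hyperbolic"
proof -
  have c: "sym a \<in> carrier R" "sym neg_one \<in> carrier R" "\<eta> \<in> carrier R"
    using assms neg_one_F_star sym_closed by (simp_all del: Diff_iff)
  have "hyperbolic \<otimes> sym a = sym a \<oplus> sym a \<oplus> \<eta> \<otimes> (sym neg_one \<otimes> sym a)"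
    unfolding hyperbolic_def using c by algebra
  also have "\<dots> = sym a \<oplus> sym a \<oplus> (\<eta> \<otimes> sym a) \<otimes> sym neg_one"
    unfolding eta_swap[OF neg_one_F_star(1) assms] using c by algebra
  also have "\<dots> = sym a \<otimes> hyperbolic"
    unfolding hyperbolic_def eta_sym[OF assms] using c by algebra simp
  finally show ?thesis .
qed

lemma hyperbolic_eta: "hyperbolic \<otimes> \<eta> = \<zero>"
proof -
  have c: "sym neg_one \<in> carrier R" "\<eta> \<in> carrier R"
    using neg_one_F_star sym_closed by (simp_all del: Diff_iff)
  have "hyperbolic \<otimes> \<eta> = \<eta> \<oplus> \<eta> \<oplus> \<eta> \<otimes> (sym neg_one \<otimes> \<eta>)"
    unfolding hyperbolic_def using c by algebra
  also have "\<dots> = \<eta> \<otimes> hyperbolic"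
    unfolding hyperbolic_def eta_sym[OF neg_one_F_star(1), symmetric] using c by algebra simp
  finally show ?thesis using eta_hyperbolic by simp
qed

lemma hyperbolic_hyperbolic: "hyperbolic \<otimes> hyperbolic = hyperbolic \<oplus> hyperbolic"
proof -
  have c: "sym neg_one \<in> carrier R" "\<eta> \<in> carrier R" "hyperbolic \<in> carrier R"
    using neg_one_F_star sym_closed by (simp_all del: Diff_iff)
  have "hyperbolic \<otimes> hyperbolic = hyperbolic \<otimes> (\<one> \<oplus> \<one> \<oplus> \<eta> \<otimes> sym neg_one)" by (simp add: hyperbolic_def)
  also have "\<dots> = hyperbolic \<oplus> hyperbolic \<oplus> (hyperbolic \<otimes> \<eta>) \<otimes> sym neg_one" using c by algebra simp
  finally show ?thesis using c by (simp add: hyperbolic_eta)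
qed

lemma mw_angle_eq: "a \<in> F_star \<Longrightarrow> mw_angle F a = \<one> \<oplus> \<eta> \<otimes> sym a"
  using sym_closed by (simp add: mw_angle_def mw_sym_def R_def[symmetric] del: Diff_iff)

lemma mw_angle_closed [simp]: "a \<in> F_star \<Longrightarrow> mw_angle F a \<in> carrier R"
  using sym_closed by (simp add: mw_angle_eq del: Diff_iff)

lemma mw_angle_mult:
  assumes "a \<in> F_star" "b \<in> F_star"
  shows "mw_angle F (a \<otimes>\<^bsub>F\<^esub> b) = mw_angle F a \<otimes> mw_angle F b"
proof -
  have c: "sym a \<in> carrier R" "sym b \<in> carrier R" "\<eta> \<in> carrier R" using assms sym_closed by simp_all
  have "mw_angle F (a \<otimes>\<^bsub>F\<^esub> b) = \<one> \<oplus> \<eta> \<otimes> sym a \<oplus> \<eta> \<otimes> sym b \<oplus> \<eta> \<otimes> (\<eta> \<otimes> sym a) \<otimes> sym b"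
    using c by (simp only: mw_angle_eq[OF mult_F_star[OF assms]] sym_mult[OF assms]) algebra
  also have "\<dots> = \<one> \<oplus> \<eta> \<otimes> sym a \<oplus> \<eta> \<otimes> sym b \<oplus> \<eta> \<otimes> (sym a \<otimes> \<eta>) \<otimes> sym b"
    by (simp only: eta_sym[OF assms(1)])
  also have "\<dots> = mw_angle F a \<otimes> mw_angle F b"
    unfolding mw_angle_eq[OF assms(1)] mw_angle_eq[OF assms(2)]
    using c by algebra simp
  finally show ?thesis .
qed

lemma mw_angle_neg_one: "mw_angle F neg_one = hyperbolic \<ominus> \<one>"
proof -
  have c: "sym neg_one \<in> carrier R" "\<eta> \<in> carrier R"
    using neg_one_F_star sym_closed by (simp_all del: Diff_iff)
  show ?thesis unfolding mw_angle_eq[OF neg_one_F_star(1)] hyperbolic_def using c by algebra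
qed

text \<open>Since \<open>\<langle>1\<rangle> = \<langle>-1\<rangle>\<langle>-1\<rangle>\<close> and \<open>\<langle>-1\<rangle> = h - 1\<close>, this is \<open>(h - 1)(h - 1) = 1\<close>, which follows from
  \<open>hh = 2h\<close>.\<close>

lemma mw_angle_one: "mw_angle F \<one>\<^bsub>F\<^esub> = \<one>"
proof -
  have c: "hyperbolic \<in> carrier R" by simp
  have "neg_one \<otimes>\<^bsub>F\<^esub> neg_one = \<one>\<^bsub>F\<^esub>" using F.l_minus F.r_minus by simp
  then have "mw_angle F \<one>\<^bsub>F\<^esub> = (hyperbolic \<ominus> \<one>) \<otimes> (hyperbolic \<ominus> \<one>)"
    using mw_angle_mult[OF neg_one_F_star(1) neg_one_F_star(1)] by (simp add: mw_angle_neg_one)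
  also have "\<dots> = hyperbolic \<otimes> hyperbolic \<ominus> hyperbolic \<ominus> hyperbolic \<oplus> \<one>" using c by algebra simp
  also have "\<dots> = \<one>" unfolding hyperbolic_hyperbolic using c by algebra
  finally show ?thesis .
qed

lemma sym_one: "sym \<one>\<^bsub>F\<^esub> = \<zero>"
proof -
  have c: "sym \<one>\<^bsub>F\<^esub> \<in> carrier R" "\<eta> \<in> carrier R"
    using neg_one_F_star sym_closed by (simp_all del: Diff_iff)
  have "\<eta> \<otimes> sym \<one>\<^bsub>F\<^esub> = mw_angle F \<one>\<^bsub>F\<^esub> \<ominus> \<one>"
    unfolding mw_angle_eq[OF neg_one_F_star(2)] using c by algebra
  then have e: "\<eta> \<otimes> sym \<one>\<^bsub>F\<^esub> = \<zero>" by (simp add: mw_angle_one)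
  have "sym \<one>\<^bsub>F\<^esub> = sym \<one>\<^bsub>F\<^esub> \<oplus> sym \<one>\<^bsub>F\<^esub>"
    using sym_mult[OF neg_one_F_star(2) neg_one_F_star(2)] c by (simp add: e)
  then show ?thesis using c by simp
qed

text \<open>The inverse of \<open>\<langle>a\<rangle>\<close> is \<open>\<langle>a\<^sup>-\<^sup>1\<rangle>\<close>.\<close>

lemma mw_angle_cancel:
  assumes "field F" "a \<in> F_star" "x \<in> carrier R" "mw_angle F a \<otimes> x = \<zero>"
  shows "x = \<zero>"
proof -
  interpret FF: field F by fact
  define b where "b = inv\<^bsub>F\<^esub> a"
  have b: "b \<in> F_star" "b \<otimes>\<^bsub>F\<^esub> a = \<one>\<^bsub>F\<^esub>"
    using assms(2) FF.field_Units F.Units_inv_Units[of a] F.Units_l_inv[of a] by (simp_all add: b_def del: F.Units_inv_Units)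
  have "mw_angle F b \<otimes> mw_angle F a = \<one>"
    using mw_angle_mult[OF b(1) assms(2)] by (simp only: b(2) mw_angle_one)
  then have "x = mw_angle F b \<otimes> mw_angle F a \<otimes> x" using assms(3) by simp
  then show ?thesis using assms b(1) by (simp add: m_assoc del: Diff_iff)
qed

text \<open>For \<open>a \<noteq> 1\<close> write \<open>1 - a = (-a)d\<close> with \<open>d = 1 - a\<^sup>-\<^sup>1\<close>. The Steinberg relation for \<open>a\<^sup>-\<^sup>1\<close> gives
  \<open>[a\<^sup>-\<^sup>1][d] = 0\<close>, hence \<open>[a][d] = 0\<close>; the one for \<open>a\<close> then reads \<open>\<langle>d\<rangle>[a][-a] = 0\<close>, and \<open>\<langle>d\<rangle>\<close> is
  invertible.\<close>

lemma sym_mult_sym_neg: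
  assumes "field F" "a \<in> F_star"
  shows "sym a \<otimes> sym (\<ominus>\<^bsub>F\<^esub> a) = \<zero>"
proof (cases "a = \<one>\<^bsub>F\<^esub>")
  case True
  then show ?thesis using neg_one_F_star sym_closed by (simp add: sym_one del: Diff_iff)
next
  case False
  interpret FF: field F by fact
  define b where "b = inv\<^bsub>F\<^esub> a"
  have b: "b \<in> F_star" "b \<otimes>\<^bsub>F\<^esub> a = \<one>\<^bsub>F\<^esub>"
    using assms(2) FF.field_Units F.Units_inv_Units[of a] F.Units_l_inv[of a] by (simp_all add: b_def del: F.Units_inv_Units)
  have ab: "a \<otimes>\<^bsub>F\<^esub> b = \<one>\<^bsub>F\<^esub>" using b assms F.m_comm by simp
  have b1: "b \<noteq> \<one>\<^bsub>F\<^esub>" using b False assms by auto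
  define d where "d = \<one>\<^bsub>F\<^esub> \<ominus>\<^bsub>F\<^esub> b"
  have d: "d \<in> F_star" using b b1 by (simp add: d_def)
  have na: "\<ominus>\<^bsub>F\<^esub> a \<in> F_star" using assms by simp
  have "(\<ominus>\<^bsub>F\<^esub> a) \<otimes>\<^bsub>F\<^esub> d = \<ominus>\<^bsub>F\<^esub> a \<oplus>\<^bsub>F\<^esub> a \<otimes>\<^bsub>F\<^esub> b"
    unfolding d_def using b(1) assms(2) by (simp, algebra)
  also have "\<dots> = \<one>\<^bsub>F\<^esub> \<ominus>\<^bsub>F\<^esub> a" unfolding ab using assms(2) by (simp, algebra)
  finally have e: "(\<ominus>\<^bsub>F\<^esub> a) \<otimes>\<^bsub>F\<^esub> d = \<one>\<^bsub>F\<^esub> \<ominus>\<^bsub>F\<^esub> a" .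
  have c: "sym a \<in> carrier R" "sym b \<in> carrier R" "sym d \<in> carrier R" "sym (\<ominus>\<^bsub>F\<^esub> a) \<in> carrier R" "\<eta> \<in> carrier R"
    using assms b d na sym_closed by (simp_all del: Diff_iff)
  have bd: "sym b \<otimes> sym d = \<zero>" unfolding d_def using sym_steinberg b(1) b1 by simp
  have "sym a \<oplus> sym b \<oplus> \<eta> \<otimes> sym a \<otimes> sym b = \<zero>"
    using sym_mult[OF assms(2) b(1)] ab sym_one by simp
  then have "(sym a \<oplus> sym b \<oplus> \<eta> \<otimes> sym a \<otimes> sym b) \<otimes> sym d = \<zero>" using c by simp
  moreover have "(sym a \<oplus> sym b \<oplus> \<eta> \<otimes> sym a \<otimes> sym b) \<otimes> sym d
      = sym a \<otimes> sym d \<oplus> (\<one> \<oplus> \<eta> \<otimes> sym a) \<otimes> (sym b \<otimes> sym d)"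
    using c by algebra
  ultimately have ad: "sym a \<otimes> sym d = \<zero>" using c by (simp add: bd)
  have "\<zero> = sym a \<otimes> sym (\<one>\<^bsub>F\<^esub> \<ominus>\<^bsub>F\<^esub> a)" using sym_steinberg assms False by simp
  also have "\<dots> = sym a \<otimes> (sym (\<ominus>\<^bsub>F\<^esub> a) \<oplus> sym d \<oplus> \<eta> \<otimes> sym (\<ominus>\<^bsub>F\<^esub> a) \<otimes> sym d)"
    using sym_mult[OF na d] e by simp
  also have "\<dots> = sym a \<otimes> sym (\<ominus>\<^bsub>F\<^esub> a) \<oplus> sym a \<otimes> sym d \<oplus> (sym a \<otimes> \<eta>) \<otimes> sym (\<ominus>\<^bsub>F\<^esub> a) \<otimes> sym d"
    using c by algebra
  also have "\<dots> = sym a \<otimes> sym (\<ominus>\<^bsub>F\<^esub> a) \<oplus> \<eta> \<otimes> sym a \<otimes> (sym (\<ominus>\<^bsub>F\<^esub> a) \<otimes> sym d)"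
    unfolding eta_sym[OF assms(2), symmetric] ad using c by algebra
  also have "\<dots> = sym a \<otimes> sym (\<ominus>\<^bsub>F\<^esub> a) \<oplus> \<eta> \<otimes> (sym a \<otimes> sym (\<ominus>\<^bsub>F\<^esub> a)) \<otimes> sym d"
    using c by algebra
  also have "\<eta> \<otimes> (sym a \<otimes> sym (\<ominus>\<^bsub>F\<^esub> a)) \<otimes> sym d = \<eta> \<otimes> sym d \<otimes> (sym a \<otimes> sym (\<ominus>\<^bsub>F\<^esub> a))"
  proof -
    have "\<eta> \<otimes> (sym a \<otimes> sym (\<ominus>\<^bsub>F\<^esub> a)) \<otimes> sym d = sym a \<otimes> (\<eta> \<otimes> (sym (\<ominus>\<^bsub>F\<^esub> a) \<otimes> sym d))"
      using c eta_sym[OF assms(2)] by (simp add: m_assoc[symmetric])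
    also have "\<dots> = sym a \<otimes> \<eta> \<otimes> (sym d \<otimes> sym (\<ominus>\<^bsub>F\<^esub> a))"
      unfolding eta_swap[OF na d] using c by algebra
    also have "\<dots> = \<eta> \<otimes> (sym a \<otimes> sym d) \<otimes> sym (\<ominus>\<^bsub>F\<^esub> a)"
      unfolding eta_sym[OF assms(2), symmetric] using c by algebra
    also have "\<dots> = \<eta> \<otimes> sym d \<otimes> (sym a \<otimes> sym (\<ominus>\<^bsub>F\<^esub> a))"
      unfolding eta_swap[OF assms(2) d] using c by algebra
    finally show ?thesis .
  qed
  also have "sym a \<otimes> sym (\<ominus>\<^bsub>F\<^esub> a) \<oplus> \<eta> \<otimes> sym d \<otimes> (sym a \<otimes> sym (\<ominus>\<^bsub>F\<^esub> a))
      = mw_angle F d \<otimes> (sym a \<otimes> sym (\<ominus>\<^bsub>F\<^esub> a))"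
    unfolding mw_angle_eq[OF d] using c by algebra
  finally show ?thesis using mw_angle_cancel[OF assms(1) d] c by simp
qed

text \<open>Write \<open>a = (-a)(-1)\<close> in the second factor and use \<open>[a][-a] = 0\<close>.\<close>

lemma sym_square:
  assumes "field F" "a \<in> F_star"
  shows "sym a \<otimes> sym a = sym a \<otimes> sym neg_one"
proof -
  have na: "\<ominus>\<^bsub>F\<^esub> a \<in> F_star" using assms by simp
  have c: "sym a \<in> carrier R" "sym neg_one \<in> carrier R" "sym (\<ominus>\<^bsub>F\<^esub> a) \<in> carrier R" "\<eta> \<in> carrier R"
    using assms na neg_one_F_star sym_closed by (simp_all del: Diff_iff)
  have "(\<ominus>\<^bsub>F\<^esub> a) \<otimes>\<^bsub>F\<^esub> neg_one = a" using assms F.l_minus F.r_minus by simp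
  then have "sym a \<otimes> sym a = sym a \<otimes> (sym (\<ominus>\<^bsub>F\<^esub> a) \<oplus> sym neg_one \<oplus> \<eta> \<otimes> sym (\<ominus>\<^bsub>F\<^esub> a) \<otimes> sym neg_one)"
    using sym_mult[OF na neg_one_F_star(1)] by simp
  also have "\<dots> = sym a \<otimes> sym (\<ominus>\<^bsub>F\<^esub> a) \<oplus> sym a \<otimes> sym neg_one \<oplus> (sym a \<otimes> \<eta>) \<otimes> sym (\<ominus>\<^bsub>F\<^esub> a) \<otimes> sym neg_one"
    using c by algebra
  also have "\<dots> = sym a \<otimes> sym (\<ominus>\<^bsub>F\<^esub> a) \<oplus> sym a \<otimes> sym neg_one \<oplus> \<eta> \<otimes> (sym a \<otimes> sym (\<ominus>\<^bsub>F\<^esub> a)) \<otimes> sym neg_one"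
    unfolding eta_sym[OF assms(2), symmetric] using c by algebra
  finally show ?thesis using c by (simp add: sym_mult_sym_neg[OF assms])
qed

text \<open>Here \<open>1 - h = -\<langle>-1\<rangle>\<close> is \<open>\<epsilon>\<close>. The identity is obtained by expanding \<open>[ab][-ab] = 0\<close> with the
  relations for \<open>[ab]\<close> and \<open>[(-a)b]\<close>: writing \<open>C = [-ab]\<close>, one has \<open>[a]C = [a][b]\<close> and
  \<open>[b]C = [b][a]\<close>, so that \<open>[ab]C = [a][b] + [b][a] + \<eta>[a][b][a]\<close>, whose last term is
  \<open>\<eta>[-1][b][a]\<close>.\<close>

lemma sym_anticommute:
  assumes "field F" "a \<in> F_star" "b \<in> F_star"
  shows "sym a \<otimes> sym b = (\<one> \<ominus> hyperbolic) \<otimes> sym b \<otimes> sym a"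
proof -
  have na: "\<ominus>\<^bsub>F\<^esub> a \<in> F_star" using assms by simp
  define A B N T where "A = sym a" and "B = sym b" and "N = sym (\<ominus>\<^bsub>F\<^esub> a)" and "T = sym neg_one"
  have c: "A \<in> carrier R" "B \<in> carrier R" "N \<in> carrier R" "T \<in> carrier R" "\<eta> \<in> carrier R"
    using assms na neg_one_F_star sym_closed by (simp_all add: A_def B_def N_def T_def del: Diff_iff)
  have eA: "A \<otimes> \<eta> = \<eta> \<otimes> A" and eB: "B \<otimes> \<eta> = \<eta> \<otimes> B"
    unfolding A_def B_def using eta_sym assms by simp_all
  have AN: "A \<otimes> N = \<zero>" unfolding A_def N_def using sym_mult_sym_neg assms by blast
  have AA: "A \<otimes> A = A \<otimes> T" and BB: "B \<otimes> B = B \<otimes> T"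
    unfolding A_def B_def T_def using sym_square assms by blast+
  have sAB: "\<eta> \<otimes> (A \<otimes> B) = \<eta> \<otimes> (B \<otimes> A)" unfolding A_def B_def by (rule eta_swap[OF assms(2,3)])
  have sNB: "\<eta> \<otimes> (N \<otimes> B) = \<eta> \<otimes> (B \<otimes> N)" unfolding N_def B_def by (rule eta_swap[OF na assms(3)])
  have sAT: "\<eta> \<otimes> (A \<otimes> T) = \<eta> \<otimes> (T \<otimes> A)" unfolding A_def T_def by (rule eta_swap[OF assms(2) neg_one_F_star(1)])
  have sBT: "\<eta> \<otimes> (B \<otimes> T) = \<eta> \<otimes> (T \<otimes> B)" unfolding B_def T_def by (rule eta_swap[OF assms(3) neg_one_F_star(1)])
  have "(\<ominus>\<^bsub>F\<^esub> a) \<otimes>\<^bsub>F\<^esub> neg_one = a" using assms F.l_minus F.r_minus by simp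
  then have A: "A = N \<oplus> T \<oplus> \<eta> \<otimes> N \<otimes> T"
    using sym_mult[OF na neg_one_F_star(1)] by (simp add: A_def N_def T_def)
  note ab = mult_F_star[OF assms(2,3)]
  have n: "\<ominus>\<^bsub>F\<^esub> (a \<otimes>\<^bsub>F\<^esub> b) = (\<ominus>\<^bsub>F\<^esub> a) \<otimes>\<^bsub>F\<^esub> b" using assms F.l_minus by simp

  have left: "A \<otimes> (N \<oplus> B \<oplus> \<eta> \<otimes> N \<otimes> B) = A \<otimes> B"
  proof -
    have "A \<otimes> (N \<oplus> B \<oplus> \<eta> \<otimes> N \<otimes> B) = A \<otimes> N \<oplus> A \<otimes> B \<oplus> (A \<otimes> \<eta>) \<otimes> N \<otimes> B"
      using c by algebra
    also have "(A \<otimes> \<eta>) \<otimes> N \<otimes> B = \<eta> \<otimes> (A \<otimes> N) \<otimes> B" unfolding eA using c by algebra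
    finally show ?thesis using c by (simp add: AN)
  qed
  have right: "B \<otimes> (N \<oplus> B \<oplus> \<eta> \<otimes> N \<otimes> B) = B \<otimes> A"
  proof -
    have "B \<otimes> \<eta> \<otimes> N \<otimes> B = \<eta> \<otimes> (B \<otimes> N) \<otimes> B" unfolding eB using c by algebra
    also have "\<dots> = \<eta> \<otimes> N \<otimes> (B \<otimes> B)" unfolding sNB[symmetric] using c by algebra
    also have "\<dots> = \<eta> \<otimes> (N \<otimes> B) \<otimes> T" unfolding BB using c by algebra
    also have "\<dots> = \<eta> \<otimes> B \<otimes> N \<otimes> T" unfolding sNB using c by algebra
    also have "\<dots> = B \<otimes> \<eta> \<otimes> N \<otimes> T" unfolding eB ..
    finally have *: "B \<otimes> \<eta> \<otimes> N \<otimes> B = B \<otimes> \<eta> \<otimes> N \<otimes> T" .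
    have "B \<otimes> (N \<oplus> B \<oplus> \<eta> \<otimes> N \<otimes> B) = B \<otimes> N \<oplus> B \<otimes> B \<oplus> B \<otimes> \<eta> \<otimes> N \<otimes> B"
      using c by algebra
    also have "\<dots> = B \<otimes> (N \<oplus> T \<oplus> \<eta> \<otimes> N \<otimes> T)" unfolding * BB using c by algebra
    finally show ?thesis unfolding A[symmetric] .
  qed
  have swap: "\<eta> \<otimes> A \<otimes> (B \<otimes> A) = \<eta> \<otimes> T \<otimes> B \<otimes> A"
  proof -
    have "\<eta> \<otimes> A \<otimes> (B \<otimes> A) = \<eta> \<otimes> (A \<otimes> B) \<otimes> A" using c by algebra
    also have "\<dots> = \<eta> \<otimes> B \<otimes> (A \<otimes> A)" unfolding sAB using c by algebra
    also have "\<dots> = B \<otimes> (\<eta> \<otimes> (A \<otimes> T))" unfolding AA eB[symmetric] using c by algebra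
    also have "\<dots> = (B \<otimes> \<eta>) \<otimes> T \<otimes> A" unfolding sAT using c by algebra
    also have "\<dots> = \<eta> \<otimes> (B \<otimes> T) \<otimes> A" unfolding eB using c by algebra
    also have "\<dots> = \<eta> \<otimes> T \<otimes> B \<otimes> A" unfolding sBT using c by algebra
    finally show ?thesis .
  qed
  define C where "C = N \<oplus> B \<oplus> \<eta> \<otimes> N \<otimes> B"
  have cC: "C \<in> carrier R" unfolding C_def using c by simp
  have "\<zero> = (A \<oplus> B \<oplus> \<eta> \<otimes> A \<otimes> B) \<otimes> (N \<oplus> B \<oplus> \<eta> \<otimes> N \<otimes> B)"
    using sym_mult_sym_neg[OF assms(1) ab] unfolding n sym_mult[OF assms(2,3)] sym_mult[OF na assms(3)] A_def B_def N_def T_def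
    by (rule HOL.sym)
  also have "\<dots> = A \<otimes> C \<oplus> B \<otimes> C \<oplus> \<eta> \<otimes> A \<otimes> (B \<otimes> C)"
    unfolding C_def[symmetric] using c cC by algebra
  also have "\<dots> = A \<otimes> B \<oplus> B \<otimes> A \<oplus> \<eta> \<otimes> T \<otimes> B \<otimes> A"
    unfolding C_def left right swap ..
  finally have "A \<otimes> B \<oplus> (B \<otimes> A \<oplus> \<eta> \<otimes> T \<otimes> B \<otimes> A) = \<zero>" using c by (simp add: a_assoc)
  then have "A \<otimes> B = \<ominus> (B \<otimes> A \<oplus> \<eta> \<otimes> T \<otimes> B \<otimes> A)"
    using c by (intro minus_equality[symmetric]) auto
  also have "\<dots> = (\<one> \<ominus> hyperbolic) \<otimes> B \<otimes> A"
    unfolding hyperbolic_def T_def[symmetric] using c by algebra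
  finally show ?thesis by (simp add: A_def B_def)
qed


section \<open>The elements attached to integers\<close>

abbreviation scalar :: "int \<Rightarrow> _" where "scalar k \<equiv> [k] \<cdot> \<one>"

lemma scalar_closed [simp]: "scalar k \<in> carrier R" by simp

lemma add_pow_int_0 [simp]: "[(0::int)] \<cdot> x = \<zero>"
  by (simp add: add_pow_def)

lemma scalar_add: "scalar (j + k) = scalar j \<oplus> scalar k"
  by (simp add: add.int_pow_mult)

lemma scalar_mult: "x \<in> carrier R \<Longrightarrow> scalar k \<otimes> x = [k] \<cdot> x" "x \<in> carrier R \<Longrightarrow> x \<otimes> scalar k = [k] \<cdot> x"
  by (simp_all add: add_pow_ldistr_int add_pow_rdistr_int)

lemma scalar_scalar: "scalar j \<otimes> scalar k = scalar (j * k)"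
  by (simp add: scalar_mult add.int_pow_pow mult.commute)

text \<open>A closed form of \<open>k\<^sub>\<epsilon>\<close> that treats both signs of \<open>k\<close> alike because \<open>div\<close> rounds down; for example
  \<open>(-1)\<^sub>\<epsilon> = -h + 1 = \<epsilon>\<close>.\<close>

definition eps :: "int \<Rightarrow> _" where "eps k = scalar (k div 2) \<otimes> hyperbolic \<oplus> scalar (k mod 2)"

lemma eps_closed [simp]: "eps k \<in> carrier R"
  by (simp add: eps_def)

lemma eps_even: "eps (2 * k) = scalar k \<otimes> hyperbolic"
  and eps_odd: "eps (2 * k + 1) = scalar k \<otimes> hyperbolic \<oplus> \<one>"
  by (simp_all add: eps_def)

lemma eps_0: "eps 0 = \<zero>" and eps_1: "eps 1 = \<one>"
  using eps_even[of 0] eps_odd[of 0] by simp_all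

lemma eps_neg_one: "eps (-1) = \<one> \<ominus> hyperbolic"
proof -
  have "hyperbolic \<in> carrier R" by simp
  then show ?thesis using eps_odd[of "-1"] by (simp add: add.int_pow_neg l_minus a_minus_def a_comm)
qed

text \<open>The recursion satisfied by the coefficients of \<open>[\<pi>]\<close> in the symbols \<open>[\<pi>\<^sup>k]\<close>.\<close>

lemma eps_Suc: "eps (k + 1) = \<one> \<oplus> eps k \<oplus> eps k \<otimes> \<eta> \<otimes> sym neg_one"
proof -
  have c: "hyperbolic \<in> carrier R" "sym neg_one \<in> carrier R" "\<eta> \<in> carrier R" 
    using neg_one_F_star sym_closed by (simp_all del: Diff_iff)
  consider j where "k = 2 * j" | j where "k = 2 * j + 1" by (metis oddE evenE)
  then show ?thesis
  proof cases
    case 1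
    have z: "scalar j \<in> carrier R" by simp
    have "eps k \<otimes> \<eta> = \<zero>" using c by (simp add: 1 eps_even m_assoc hyperbolic_eta)
    then show ?thesis using c by (simp add: 1 eps_odd eps_even a_comm)
  next
    case 2
    have z: "scalar j \<in> carrier R" by simp
    have "eps k \<otimes> \<eta> = \<eta>" using c by (simp add: 2 eps_odd l_distr m_assoc hyperbolic_eta)
    moreover have "eps (k + 1) = scalar j \<otimes> hyperbolic \<oplus> hyperbolic"
      using eps_even[of "j + 1"] c by (simp add: 2 scalar_add l_distr a_comm add.commute del: add.int_pow_mult)
    moreover have "scalar j \<otimes> hyperbolic \<oplus> hyperbolic = \<one> \<oplus> (scalar j \<otimes> hyperbolic \<oplus> \<one>) \<oplus> \<eta> \<otimes> sym neg_one"
      unfolding hyperbolic_def using c z by algebra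
    ultimately show ?thesis using eps_odd[of j] by (simp add: 2)
  qed
qed

text \<open>With \<open>k = 2a + b\<close> and \<open>l = 2c + d\<close>, where \<open>b, d \<in> {0, 1}\<close>, the relation \<open>hh = 2h\<close> gives the
  coefficient \<open>2ac + ad + bc\<close> of \<open>h\<close>, and this is \<open>kl div 2\<close> because \<open>bd \<in> {0, 1}\<close>.\<close>

lemma eps_mult: "eps k \<otimes> eps l = eps (k * l)"
proof -
  define a b c d where "a = k div 2" and "b = k mod 2" and "c = l div 2" and "d = l mod 2"
  have k: "k = 2 * a + b" and l: "l = 2 * c + d" by (simp_all add: a_def b_def c_def d_def)
  have bd: "b * d = 0 \<or> b * d = 1" unfolding b_def d_def by (auto simp: mod2_eq_if)
  have "k * l = 2 * (2 * a * c + a * d + b * c) + b * d" unfolding k l by (simp add: algebra_simps)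
  then have kl: "eps (k * l) = scalar (2 * a * c + a * d + b * c) \<otimes> hyperbolic \<oplus> scalar (b * d)"
    using bd by (elim disjE) (simp_all only: eps_even eps_odd add_0_right add_pow_int_0 add.int_pow_1 one_closed
          r_zero m_closed hyperbolic_closed scalar_closed)
  have C: "scalar a \<in> carrier R" "scalar b \<in> carrier R" "scalar c \<in> carrier R" "scalar d \<in> carrier R" "hyperbolic \<in> carrier R"
    by simp_all
  have "eps k \<otimes> eps l = scalar a \<otimes> (hyperbolic \<otimes> scalar c) \<otimes> hyperbolic \<oplus> scalar a \<otimes> (hyperbolic \<otimes> scalar d) \<oplus> scalar b \<otimes> scalar c \<otimes> hyperbolic \<oplus> scalar b \<otimes> scalar d"
    unfolding eps_def a_def[symmetric] b_def[symmetric] c_def[symmetric] d_def[symmetric]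
    using C by algebra
  also have "\<dots> = scalar a \<otimes> scalar c \<otimes> (hyperbolic \<otimes> hyperbolic) \<oplus> scalar a \<otimes> scalar d \<otimes> hyperbolic \<oplus> scalar b \<otimes> scalar c \<otimes> hyperbolic \<oplus> scalar b \<otimes> scalar d"
    unfolding scalar_mult(2)[OF C(5)] scalar_mult(1)[OF C(5), symmetric] using C by algebra
  also have "\<dots> = (scalar a \<otimes> scalar c \<oplus> scalar a \<otimes> scalar c \<oplus> scalar a \<otimes> scalar d \<oplus> scalar b \<otimes> scalar c) \<otimes> hyperbolic \<oplus> scalar b \<otimes> scalar d"
    unfolding hyperbolic_hyperbolic using C by algebra
  also have "\<dots> = eps (k * l)"
    unfolding kl scalar_scalar scalar_add[symmetric] by (simp add: algebra_simps)
  finally show ?thesis .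
qed

lemma eps_sym:
  assumes "a \<in> F_star" shows "eps k \<otimes> sym a = sym a \<otimes> eps k"
proof -
  have c: "hyperbolic \<in> carrier R" "sym a \<in> carrier R" "scalar (k div 2) \<in> carrier R" "scalar (k mod 2) \<in> carrier R" 
    using assms sym_closed by (simp_all del: Diff_iff)
  have "eps k \<otimes> sym a = scalar (k div 2) \<otimes> (hyperbolic \<otimes> sym a) \<oplus> scalar (k mod 2) \<otimes> sym a"
    unfolding eps_def using c by algebra
  also have "\<dots> = (scalar (k div 2) \<otimes> sym a) \<otimes> hyperbolic \<oplus> scalar (k mod 2) \<otimes> sym a"
    unfolding hyperbolic_sym[OF assms] using c by algebra
  also have "\<dots> = sym a \<otimes> eps k"
    unfolding eps_def scalar_mult(1)[OF c(2)] scalar_mult(2)[OF c(2), symmetric] using c by algebra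
  finally show ?thesis .
qed

lemma eps_eta: "eps k \<otimes> \<eta> = [chi_odd k] \<cdot> \<eta>" "\<eta> \<otimes> eps k = [chi_odd k] \<cdot> \<eta>"
proof -
  consider j where "k = 2 * j" | j where "k = 2 * j + 1" by (metis oddE evenE)
  then have "eps k \<otimes> \<eta> = [chi_odd k] \<cdot> \<eta> \<and> \<eta> \<otimes> eps k = [chi_odd k] \<cdot> \<eta>"
  proof cases
    case 1
    have "\<eta> \<otimes> (hyperbolic \<otimes> scalar j) = \<zero>" by (simp add: m_assoc[symmetric] eta_hyperbolic)
    then show ?thesis
      by (simp add: 1 eps_even chi_odd_def scalar_mult add_pow_ldistr_int add_pow_rdistr_int hyperbolic_eta)
  next
    case 2
    have "\<eta> \<otimes> (hyperbolic \<otimes> scalar j) = \<zero>" by (simp add: m_assoc[symmetric] eta_hyperbolic)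
    then show ?thesis
      by (simp add: 2 eps_odd chi_odd_def scalar_mult l_distr r_distr add_pow_ldistr_int add_pow_rdistr_int hyperbolic_eta)
  qed
  then show "eps k \<otimes> \<eta> = [chi_odd k] \<cdot> \<eta>" "\<eta> \<otimes> eps k = [chi_odd k] \<cdot> \<eta>" by auto
qed

lemma mw_nat_eps_eq: "mw_nat_eps F n = eps (int n)"
proof (induction n)
  case 0
  then show ?case by (simp add: mw_nat_eps_def R_def[symmetric] eps_0)
next
  case (Suc n)
  have pow: "neg_one [^]\<^bsub>F\<^esub> k = (if even k then \<one>\<^bsub>F\<^esub> else neg_one)" for k :: nat
    by (induction k) (auto simp: F.l_minus F.r_minus)
  have ang: "mw_angle F (neg_one [^]\<^bsub>F\<^esub> k) = (if even k then \<one> else hyperbolic \<ominus> \<one>)" for k :: nat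
    by (simp add: pow mw_angle_one mw_angle_neg_one)
  have "mw_nat_eps F (Suc n) = mw_angle F (neg_one [^]\<^bsub>F\<^esub> n) \<oplus> mw_nat_eps F n"
    unfolding mw_nat_eps_def R_def[symmetric]
    by (simp add: atLeastAtMostSuc_conv ang)
  also have "\<dots> = eps (int (Suc n))"
  proof -
    have c: "hyperbolic \<in> carrier R" by simp
    consider j where "n = 2 * j" | j where "n = 2 * j + 1" by (metis oddE evenE)
    then show ?thesis
    proof cases
      case 1
      then show ?thesis
        using eps_even[of "int j"] eps_odd[of "int j"] using Suc by (simp add: 1 ang a_comm add.commute)
    next
      case 2
      have z: "scalar (int j) \<in> carrier R" by simp
      have "eps (int (Suc n)) = scalar (int j) \<otimes> hyperbolic \<oplus> hyperbolic"
        using eps_even[of "int j + 1"] c by (simp add: 2 scalar_add l_distr a_comm algebra_simps del: add.int_pow_mult)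
      moreover have "scalar (int j) \<otimes> hyperbolic \<oplus> hyperbolic = hyperbolic \<ominus> \<one> \<oplus> (scalar (int j) \<otimes> hyperbolic \<oplus> \<one>)"
        using c z by algebra
      moreover have "mw_angle F (neg_one [^]\<^bsub>F\<^esub> n) = hyperbolic \<ominus> \<one>"
        unfolding ang using 2 by simp
      moreover have "mw_nat_eps F n = scalar (int j) \<otimes> hyperbolic \<oplus> \<one>"
        using Suc eps_odd[of "int j"] 2 by (simp add: algebra_simps)
      ultimately show ?thesis by simp
    qed
  qed
  finally show ?case .
qed

lemma mw_int_eps_eq: "mw_int_eps F k = eps k"
proof -
  have c: "hyperbolic \<in> carrier R" by simp
  have "mw_epsilon F = eps (-1)"
    unfolding mw_epsilon_def R_def[symmetric] mw_angle_neg_one eps_neg_one using c by algebra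
  then show ?thesis
    by (auto simp: mw_int_eps_def mw_nat_eps_eq R_def[symmetric] eps_mult)
qed

section \<open>Symbols with a uniformizing parameter\<close>

lemma mw_sym_Nil: "mw_sym F [] = \<one>" and mw_sym_Cons: "mw_sym F (a # as) = sym a \<otimes> mw_sym F as"
  by (simp_all add: mw_sym_def R_def)

lemma mw_sym_closed [simp]: "set as \<subseteq> F_star \<Longrightarrow> mw_sym F as \<in> carrier R"
proof (induction as)
  case (Cons a as)
  then have "sym a \<in> carrier R" using sym_closed by simp
  then show ?case using Cons by (simp add: mw_sym_Cons)
qed (simp add: mw_sym_Nil)

lemma mw_sym_append:
  "set as \<subseteq> F_star \<Longrightarrow> set bs \<subseteq> F_star \<Longrightarrow> mw_sym F (as @ bs) = mw_sym F as \<otimes> mw_sym F bs"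
proof (induction as)
  case (Cons a as)
  then have "sym a \<in> carrier R" using sym_closed by simp
  then show ?case using Cons by (simp add: mw_sym_Cons m_assoc)
qed (simp add: mw_sym_Nil)

lemma mw_sym_snoc:
  "set as \<subseteq> F_star \<Longrightarrow> b \<in> F_star \<Longrightarrow> mw_sym F (as @ [b]) = mw_sym F as \<otimes> sym b"
  using mw_sym_append[of as "[b]"] sym_closed by (simp add: mw_sym_Cons mw_sym_Nil)

lemma commute_mult:
  assumes "x \<in> carrier R" "y \<in> carrier R" "z \<in> carrier R"
    and "x \<otimes> y = y \<otimes> x" "x \<otimes> z = z \<otimes> x"
  shows "x \<otimes> (y \<otimes> z) = (y \<otimes> z) \<otimes> x"
  using assms by (metis m_assoc)

lemma eps_mw_sym:
  "set as \<subseteq> F_star \<Longrightarrow> eps k \<otimes> mw_sym F as = mw_sym F as \<otimes> eps k"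
proof (induction as)
  case (Cons a as)
  then have "sym a \<in> carrier R" using sym_closed by simp
  moreover have "set as \<subseteq> F_star" using Cons by simp
  moreover have "eps k \<otimes> sym a = sym a \<otimes> eps k" using Cons eps_sym by simp
  moreover note Cons.IH[OF \<open>set as \<subseteq> F_star\<close>]
  ultimately show ?case unfolding mw_sym_Cons by (rule commute_mult[OF eps_closed _ mw_sym_closed])
qed (simp add: mw_sym_Nil)

lemma eta_mw_sym:
  "set as \<subseteq> F_star \<Longrightarrow> \<eta> \<otimes> mw_sym F as = mw_sym F as \<otimes> \<eta>"
proof (induction as)
  case (Cons a as)
  then have "sym a \<in> carrier R" using sym_closed by simp
  moreover have "set as \<subseteq> F_star" using Cons by simp
  moreover have "\<eta> \<otimes> sym a = sym a \<otimes> \<eta>" using Cons eta_sym by simp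
  moreover note Cons.IH[OF \<open>set as \<subseteq> F_star\<close>]
  ultimately show ?case unfolding mw_sym_Cons by (rule commute_mult[OF eta_closed _ mw_sym_closed])
qed (simp add: mw_sym_Nil)


lemma mw_sym_anticommute:
  assumes "field F" "p \<in> F_star" "set us \<subseteq> F_star"
  shows "mw_sym F us \<otimes> sym p = eps ((-1) ^ length us) \<otimes> (sym p \<otimes> mw_sym F us)"
  using assms(3)
proof (induction us)
  case Nil
  then show ?case using assms(2) sym_closed by (simp add: mw_sym_Nil eps_1 del: Diff_iff)
next
  case (Cons a us)
  let ?S = "mw_sym F us" and ?e = "eps ((-1) ^ length us)"
  have a: "a \<in> F_star" and us: "set us \<subseteq> F_star" using Cons.prems by auto
  note c = sym_closed[OF assms(2)] sym_closed[OF a] mw_sym_closed[OF us] eps_closed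
  have "mw_sym F (a # us) \<otimes> sym p = sym a \<otimes> (?S \<otimes> sym p)"
    unfolding mw_sym_Cons using c by (simp add: m_assoc)
  also have "\<dots> = (sym a \<otimes> ?e) \<otimes> (sym p \<otimes> ?S)"
    unfolding Cons.IH[OF us] using c by (simp add: m_assoc)
  also have "\<dots> = ?e \<otimes> (sym a \<otimes> sym p) \<otimes> ?S"
    unfolding eps_sym[OF a, symmetric] using c by (simp add: m_assoc)
  also have "\<dots> = (?e \<otimes> eps (-1)) \<otimes> (sym p \<otimes> mw_sym F (a # us))"
    unfolding sym_anticommute[OF assms(1) a assms(2)] eps_neg_one[symmetric] mw_sym_Cons
    using c by (simp add: m_assoc)
  also have "?e \<otimes> eps (-1) = eps ((-1) ^ length (a # us))"
    unfolding eps_mult by simp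
  finally show ?case .
qed

text \<open>Both \<open>[p\<^sup>k]\<close> and \<open>k\<^sub>\<epsilon>[p]\<close> satisfy \<open>x\<^sub>k\<^sub>+\<^sub>1 = [p] + \<langle>p\<rangle>x\<^sub>k\<close> and vanish for \<open>k = 0\<close>. As \<open>\<langle>p\<rangle>\<close> can be
  cancelled, the recursion also determines the values for negative \<open>k\<close>.\<close>

lemma sym_int_pow:
  assumes "field F" "p \<in> F_star"
  shows "p [^]\<^bsub>F\<^esub> (m :: int) \<in> F_star" "sym (p [^]\<^bsub>F\<^esub> m) = eps m \<otimes> sym p"
proof -
  interpret FF: field F by fact
  interpret G: group "units_of F" by (rule F.units_group)
  have p: "p \<in> carrier (units_of F)"
    using assms(2) by (simp add: units_of_carrier FF.field_Units)
  have eq: "p [^]\<^bsub>F\<^esub> k = p [^]\<^bsub>units_of F\<^esub> k" for k :: int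
    using p unfolding int_pow_def2 units_of_carrier
    by (simp only: F.units_of_pow F.units_of_inv F.Units_pow_closed split: if_split)
  have cl: "p [^]\<^bsub>F\<^esub> k \<in> F_star" for k :: int
    unfolding eq using G.int_pow_closed[OF p, of k] by (simp add: units_of_carrier FF.field_Units)
  have step: "p [^]\<^bsub>F\<^esub> (k + 1) = p \<otimes>\<^bsub>F\<^esub> p [^]\<^bsub>F\<^esub> k" for k :: int
    unfolding eq using G.int_pow_mult[OF p, of 1 k] p
    by (simp add: add.commute units_of_mult)
  show "p [^]\<^bsub>F\<^esub> m \<in> F_star" by (rule cl)
  note c = sym_closed[OF assms(2)] sym_closed[OF neg_one_F_star(1)] eta_closed
  have L: "sym (p [^]\<^bsub>F\<^esub> (k + 1)) = sym p \<oplus> mw_angle F p \<otimes> sym (p [^]\<^bsub>F\<^esub> k)" for k :: int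
    unfolding step sym_mult[OF assms(2) cl] mw_angle_eq[OF assms(2)]
    using c sym_closed[OF cl, of k] by algebra
  have Rr: "eps (k + 1) \<otimes> sym p = sym p \<oplus> mw_angle F p \<otimes> (eps k \<otimes> sym p)" for k
  proof -
    have "eps (k + 1) \<otimes> sym p = sym p \<oplus> eps k \<otimes> sym p \<oplus> eps k \<otimes> (\<eta> \<otimes> (sym neg_one \<otimes> sym p))"
      unfolding eps_Suc using c eps_closed[of k] by algebra
    also have "\<dots> = sym p \<oplus> eps k \<otimes> sym p \<oplus> (eps k \<otimes> \<eta>) \<otimes> (sym p \<otimes> sym neg_one)"
      unfolding eta_swap[OF neg_one_F_star(1) assms(2)] using c eps_closed[of k] by algebra
    also have "\<dots> = sym p \<oplus> eps k \<otimes> sym p \<oplus> \<eta> \<otimes> (eps k \<otimes> sym p) \<otimes> sym p"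
      unfolding sym_square[OF assms, symmetric] eps_eta(1) eps_eta(2)[symmetric]
      using c eps_closed[of k] by algebra
    also have "\<dots> = sym p \<oplus> eps k \<otimes> sym p \<oplus> \<eta> \<otimes> (sym p \<otimes> eps k) \<otimes> sym p"
      by (simp only: eps_sym[OF assms(2)])
    also have "\<dots> = sym p \<oplus> mw_angle F p \<otimes> (eps k \<otimes> sym p)"
      unfolding mw_angle_eq[OF assms(2)] using c eps_closed[of k] by algebra
    finally show ?thesis .
  qed
  have c': "mw_angle F p \<in> carrier R" using assms(2) by (rule mw_angle_closed)
  show "sym (p [^]\<^bsub>F\<^esub> m) = eps m \<otimes> sym p"
  proof (induction m rule: int_induct[where k = 0])
    case base
    show ?case using c by (simp add: sym_one eps_0)
  next
    case (step1 i)
    then show ?case unfolding L Rr by simp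
  next
    case (step2 i)
    let ?x = "sym (p [^]\<^bsub>F\<^esub> (i - 1))" and ?y = "eps (i - 1) \<otimes> sym p"
    have cx: "?x \<in> carrier R" "?y \<in> carrier R"
      using sym_closed[OF cl] c by (simp_all del: Diff_iff)
    have "sym p \<oplus> mw_angle F p \<otimes> ?x = sym p \<oplus> mw_angle F p \<otimes> ?y"
      using L[of "i - 1"] Rr[of "i - 1"] step2 by simp
    then have "mw_angle F p \<otimes> ?x = mw_angle F p \<otimes> ?y"
      by (rule add.l_cancel) (use cx c c' in simp_all)
    then have "mw_angle F p \<otimes> (?x \<ominus> ?y) = \<zero>"
      using cx c' by (simp add: a_minus_def r_distr r_minus r_neg)
    then have "?x \<ominus> ?y = \<zero>" using mw_angle_cancel[OF assms(1,2)] cx by simp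
    then show ?case using cx by simp
  qed
qed

lemma eta_pow_commute:
  shows "x \<in> carrier R \<Longrightarrow> \<eta> \<otimes> x = x \<otimes> \<eta> \<Longrightarrow> \<eta> [^] (e::nat) \<otimes> x = x \<otimes> \<eta> [^] e"
proof (induction e)
  case (Suc e)
  then have "\<eta> [^] Suc e \<otimes> x = \<eta> [^] e \<otimes> (x \<otimes> \<eta>)" by (simp add: m_assoc)
  also have "\<dots> = (\<eta> [^] e \<otimes> x) \<otimes> \<eta>" using Suc.prems(1) by (simp add: m_assoc)
  also have "\<dots> = x \<otimes> \<eta> [^] Suc e" using Suc.prems(1) unfolding Suc.IH[OF Suc.prems] by (simp add: m_assoc)
  finally show ?case .
qed simp

lemma eta_mw_angle:
  assumes "a \<in> F_star"
  shows "\<eta> \<otimes> mw_angle F a = mw_angle F a \<otimes> \<eta>"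
proof -
  note c = sym_closed[OF assms] eta_closed
  have "\<eta> \<otimes> mw_angle F a = \<eta> \<oplus> \<eta> \<otimes> (\<eta> \<otimes> sym a)"
    unfolding mw_angle_eq[OF assms] using c by (simp add: r_distr)
  also have "\<dots> = mw_angle F a \<otimes> \<eta>"
    unfolding mw_angle_eq[OF assms] using c
    by (simp add: l_distr m_assoc eta_sym[OF assms, symmetric])
  finally show ?thesis .
qed

lemma eps_eta_pow: "eps k \<otimes> \<eta> [^] (e::nat) = \<eta> [^] e \<otimes> eps k"
  by (rule eta_pow_commute[symmetric]) (simp_all add: eps_eta)

lemma eps_eta_pow_odd:
  assumes "e > 0" shows "eps k \<otimes> \<eta> [^] (e::nat) = [chi_odd k] \<cdot> (\<eta> [^] e)"
proof -
  obtain d where e: "e = Suc d" using assms by (metis gr0_conv_Suc)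
  have "\<eta> [^] e = \<eta> \<otimes> \<eta> [^] d" unfolding e using nat_pow_Suc2 by simp
  then show ?thesis by (simp add: m_assoc[symmetric] eps_eta add_pow_ldistr_int)
qed

text \<open>The normal form \<open>c\<^sub>\<epsilon> \<eta>\<^sup>e [p, \<dots>, p, us]\<close> with \<open>r\<close> entries \<open>p\<close>. The terms of the expansion have
  this form over \<open>F\<close> with \<open>p = \<pi>\<close>, and their residues have it over \<open>\<kappa>\<close> with \<open>p = -1\<close>.\<close>

definition eps_monomial :: "'a \<Rightarrow> int \<Rightarrow> nat \<Rightarrow> nat \<Rightarrow> 'a list \<Rightarrow> _" where
  "eps_monomial p c e r us = eps c \<otimes> \<eta> [^] e \<otimes> mw_sym F (replicate r p @ us)"

lemma eps_monomial_list: "p \<in> F_star \<Longrightarrow> set us \<subseteq> F_star \<Longrightarrow> set (replicate r p @ us) \<subseteq> F_star"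
  by (auto simp: set_replicate_conv_if)

lemma eps_monomial_closed: "p \<in> F_star \<Longrightarrow> set us \<subseteq> F_star \<Longrightarrow> eps_monomial p c e r us \<in> carrier R"
  unfolding eps_monomial_def using mw_sym_closed[OF eps_monomial_list] by (simp del: Diff_iff)

lemma eps_monomial_parity: "e > 0 \<Longrightarrow> odd c = odd c' \<Longrightarrow> eps_monomial p c e r us = eps_monomial p c' e r us"
  by (simp add: eps_monomial_def eps_eta_pow_odd chi_odd_def)

lemma eps_monomial_sym:
  assumes "p \<in> F_star" "set us \<subseteq> F_star" "a \<in> F_star"
  shows "eps_monomial p c e r us \<otimes> sym a = eps_monomial p c e r (us @ [a])"
proof -
  note l = eps_monomial_list[OF assms(1,2), of r]
  show ?thesis
    unfolding eps_monomial_def append_assoc[symmetric] mw_sym_snoc[OF l assms(3)]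
    using mw_sym_closed[OF l] sym_closed[OF assms(3)] by (simp add: m_assoc)
qed

lemma eps_monomial_eta:
  assumes "p \<in> F_star" "set us \<subseteq> F_star"
  shows "eps_monomial p c e r us \<otimes> \<eta> = eps_monomial p c (Suc e) r us"
proof -
  note l = eps_monomial_list[OF assms(1,2), of r]
  show ?thesis
    unfolding eps_monomial_def
    using mw_sym_closed[OF l] eta_mw_sym[OF l] by (simp add: m_assoc)
qed

text \<open>Each of the \<open>length us\<close> transpositions needed to move the new \<open>[p]\<close> to the left costs a factor
  \<open>\<epsilon> = (-1)\<^sub>\<epsilon>\<close>.\<close>

lemma eps_monomial_sym_p:
  assumes "field F" "p \<in> F_star" "set us \<subseteq> F_star"
  shows "eps_monomial p c e r us \<otimes> (eps m \<otimes> sym p) = eps_monomial p (c * m * (-1) ^ length us) e (Suc r) us"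
proof -
  have lP: "set (replicate r p) \<subseteq> F_star" using assms(2) by auto
  define P S h q where "P = mw_sym F (replicate r p)" and "S = mw_sym F us" and "h = \<eta> [^] e" and "q = sym p"
  let ?s = "(-1) ^ length us :: int"
  have c: "P \<in> carrier R" "S \<in> carrier R" "h \<in> carrier R" "q \<in> carrier R"
    using mw_sym_closed[OF lP] mw_sym_closed[OF assms(3)] sym_closed[OF assms(2)]
    by (simp_all add: P_def S_def h_def q_def)
  have Pq: "P \<otimes> q = mw_sym F (replicate (Suc r) p)"
    unfolding P_def q_def using mw_sym_snoc[OF lP assms(2)] by (simp add: replicate_append_same)
  have eP: "eps k \<otimes> P = P \<otimes> eps k" and eS: "eps k \<otimes> S = S \<otimes> eps k" and eh: "eps k \<otimes> h = h \<otimes> eps k" for k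
    unfolding P_def S_def h_def using eps_mw_sym lP assms(3) eps_eta_pow by auto
  have "eps_monomial p c e r us \<otimes> (eps m \<otimes> q) = eps c \<otimes> h \<otimes> P \<otimes> (S \<otimes> eps m) \<otimes> q"
    unfolding eps_monomial_def mw_sym_append[OF lP assms(3)] P_def[symmetric] S_def[symmetric] h_def[symmetric]
    using c by (simp add: m_assoc)
  also have "\<dots> = eps c \<otimes> h \<otimes> P \<otimes> eps m \<otimes> (S \<otimes> q)"
    unfolding eS[symmetric] using c by (simp add: m_assoc)
  also have "\<dots> = eps c \<otimes> h \<otimes> (P \<otimes> (eps m \<otimes> eps ?s)) \<otimes> q \<otimes> S"
    unfolding S_def q_def mw_sym_anticommute[OF assms]
    unfolding S_def[symmetric] q_def[symmetric] using c by (simp add: m_assoc)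
  also have "\<dots> = eps c \<otimes> (h \<otimes> eps (m * ?s)) \<otimes> P \<otimes> q \<otimes> S"
    unfolding eps_mult eP[symmetric] using c by (simp add: m_assoc)
  also have "\<dots> = (eps c \<otimes> eps (m * ?s)) \<otimes> h \<otimes> ((P \<otimes> q) \<otimes> S)"
    unfolding eh[symmetric] using c by (simp add: m_assoc)
  also have "\<dots> = eps_monomial p (c * m * ?s) e (Suc r) us"
  proof -
    have "set (replicate (Suc r) p) \<subseteq> F_star" using assms(2) by auto
    then show ?thesis
      unfolding eps_monomial_def eps_mult S_def Pq h_def by (simp only: mw_sym_append[OF _ assms(3)] mult.assoc)
  qed
  finally show ?thesis unfolding q_def .
qed

text \<open>The inductive step of the expansion. The sign is absent from the third summand because a factor
  \<open>\<eta>\<close> leaves only the parity of the coefficient.\<close>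

lemma eps_monomial_sym_pow_mult:
  assumes "field F" "p \<in> F_star" "set us \<subseteq> F_star" "a \<in> F_star"
  shows "eps_monomial p c e r us \<otimes> sym (p [^]\<^bsub>F\<^esub> (m::int) \<otimes>\<^bsub>F\<^esub> a) =
    eps_monomial p (c * m * (-1) ^ length us) e (Suc r) us \<oplus> eps_monomial p c e r (us @ [a]) \<oplus>
    eps_monomial p (c * m) (Suc e) (Suc r) (us @ [a])"
proof -
  let ?T = "eps_monomial p c e r us"
  note cT = eps_monomial_closed[OF assms(2,3), of c e r]
  note c = sym_closed[OF assms(2)] sym_closed[OF assms(4)]
  have "?T \<otimes> sym (p [^]\<^bsub>F\<^esub> m \<otimes>\<^bsub>F\<^esub> a) =
    ?T \<otimes> (eps m \<otimes> sym p) \<oplus> ?T \<otimes> sym a \<oplus> ?T \<otimes> \<eta> \<otimes> (eps m \<otimes> sym p) \<otimes> sym a"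
    unfolding sym_mult[OF sym_int_pow(1)[OF assms(1,2)] assms(4)] sym_int_pow(2)[OF assms(1,2)]
    using cT c by (simp add: r_distr m_assoc)
  also have "?T \<otimes> \<eta> \<otimes> (eps m \<otimes> sym p) \<otimes> sym a = eps_monomial p (c * m) (Suc e) (Suc r) (us @ [a])"
    unfolding eps_monomial_eta[OF assms(2,3)] eps_monomial_sym_p[OF assms(1-3)] eps_monomial_sym[OF assms(2-4)]
    by (rule eps_monomial_parity) simp_all
  finally show ?thesis
    unfolding eps_monomial_sym_p[OF assms(1-3)] eps_monomial_sym[OF assms(2-4)] .
qed

end

section \<open>Expanding a product of symbols\<close>

text \<open>The \<open>i\<close>-th summand is the number of elements of \<open>{1..n} - J\<close> above \<open>j\<^sub>i\<close>. So this counts the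
  transpositions needed to move the factors \<open>[\<pi>]\<close> from the positions outside \<open>J\<close> to the left of the
  symbols \<open>[u\<^sub>j]\<close>, \<open>j \<in> J\<close>.\<close>

definition shuffle_exp :: "nat \<Rightarrow> nat set \<Rightarrow> nat" where
  "shuffle_exp n J = (\<Sum>i = 1..card J. n - card J + i - nth_elem J i)"

lemma sorted_list_of_set_insert_Suc:
  assumes "J \<subseteq> {1..n}"
  shows "sorted_list_of_set (insert (Suc n) J) = sorted_list_of_set J @ [Suc n]"
proof -
  have fin: "finite J" using assms finite_subset by blast
  have "sorted_wrt (<) (sorted_list_of_set J @ [Suc n])"
    using assms fin by (auto simp: sorted_wrt_append)
  moreover have "set (sorted_list_of_set J @ [Suc n]) = insert (Suc n) J" using fin by simp
  ultimately show ?thesis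
    using fin by (metis finite_insert sorted_list_of_set.idem_if_sorted_distinct strict_sorted_iff
        sorted_list_of_set_sort_remdups sorted_sort_id distinct_remdups_id)
qed

lemma card_insert_Suc:
  "J \<subseteq> {1..n} \<Longrightarrow> card (insert (Suc n) J) = Suc (card J)"
  by (subst card_insert_disjoint) (auto intro: finite_subset)

lemma nth_elem_insert_Suc:
  assumes "J \<subseteq> {1..n}" "1 \<le> i" "i \<le> card J"
  shows "nth_elem (insert (Suc n) J) i = nth_elem J i"
proof -
  have "i - 1 < length (sorted_list_of_set J)" using assms(2,3) by simp
  then show ?thesis
    unfolding nth_elem_def sorted_list_of_set_insert_Suc[OF assms(1)] nth_append by (rule if_P)
qed

lemma nth_elem_insert_Suc_last:
  assumes "J \<subseteq> {1..n}"
  shows "nth_elem (insert (Suc n) J) (Suc (card J)) = Suc n"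
  unfolding nth_elem_def sorted_list_of_set_insert_Suc[OF assms] nth_append by simp

text \<open>The subtraction in the definition of \<open>shuffle_exp\<close> does not truncate: the elements of \<open>J\<close> after the
  \<open>i\<close>-th one all lie between its successor and \<open>n\<close>.\<close>

lemma nth_elem_le:
  assumes "J \<subseteq> {1..n}" "1 \<le> i" "i \<le> card J"
  shows "nth_elem J i \<le> n - card J + i"
proof -
  have fin: "finite J" using assms finite_subset by blast
  let ?xs = "sorted_list_of_set J"
  have len: "length ?xs = card J" by simp
  have srt: "sorted_wrt (<) ?xs" using strict_sorted_list_of_set .
  have "set (drop i ?xs) \<subseteq> {Suc (nth_elem J i)..n}"
  proof
    fix x assume "x \<in> set (drop i ?xs)"
    then obtain k where "k < length (drop i ?xs)" "x = drop i ?xs ! k"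
      by (metis in_set_conv_nth)
    then have k: "i + k < card J" "x = ?xs ! (i + k)" using len by auto
    then have "x \<in> J" using fin len nth_mem set_sorted_list_of_set by metis
    moreover have "?xs ! (i - 1) < x"
      unfolding k(2) using srt k(1) assms by (intro sorted_wrt_nth_less[of "(<)"]) auto
    ultimately show "x \<in> {Suc (nth_elem J i)..n}"
      using assms by (auto simp: nth_elem_def)
  qed
  then have "card (set (drop i ?xs)) \<le> card {Suc (nth_elem J i)..n}"
    by (intro card_mono) auto
  moreover have "card (set (drop i ?xs)) = card J - i"
    by (simp add: distinct_card)
  moreover have "card J \<le> n" using card_mono[OF _ assms(1)] by simp
  moreover have "nth_elem J i \<in> J"
    unfolding nth_elem_def using assms fin len nth_mem[of "i - 1" ?xs] by simp
  then have "nth_elem J i \<le> n" using assms by auto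
  ultimately show ?thesis using assms by simp
qed

lemma shuffle_exp_Suc:
  assumes "J \<subseteq> {1..n}"
  shows "shuffle_exp (Suc n) J = shuffle_exp n J + card J"
proof -
  have le: "card J \<le> n" using card_mono[OF _ assms] by simp
  have "shuffle_exp (Suc n) J = (\<Sum>i = 1..card J. (n - card J + i - nth_elem J i) + 1)"
    unfolding shuffle_exp_def
    by (rule sum.cong) (use le nth_elem_le[OF assms] in \<open>auto simp: Suc_diff_le\<close>)
  also have "\<dots> = shuffle_exp n J + card J" unfolding sum.distrib shuffle_exp_def by simp
  finally show ?thesis .
qed

lemma shuffle_exp_insert_Suc:
  assumes "J \<subseteq> {1..n}"
  shows "shuffle_exp (Suc n) (insert (Suc n) J) = shuffle_exp n J"
proof -
  have le: "card J \<le> n" using card_mono[OF _ assms] by simp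
  have "shuffle_exp (Suc n) (insert (Suc n) J)
      = (\<Sum>i = 1..card J. n - card J + i - nth_elem (insert (Suc n) J) i)"
    unfolding shuffle_exp_def card_insert_Suc[OF assms] using le
    by (simp add: nth_elem_insert_Suc_last[OF assms])
  then show ?thesis
    unfolding shuffle_exp_def by (simp add: nth_elem_insert_Suc[OF assms])
qed

text \<open>A pair records which summand of \<open>m\<^sub>\<epsilon>[\<pi>] + [u] + \<eta> m\<^sub>\<epsilon>[\<pi>][u]\<close> is chosen in each of \<open>n\<close> factors: the first
  outside \<open>J\<close>, the second on \<open>J - I\<close> and the third on \<open>I\<close>.\<close>

definition nested_pairs :: "nat \<Rightarrow> (nat set \<times> nat set) set" where
  "nested_pairs n = {(I, J). I \<subseteq> J \<and> J \<subseteq> {1..n}}"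

lemma finite_nested_pairs: "finite (nested_pairs n)"
  by (rule finite_subset[of _ "Pow {1..n} \<times> Pow {1..n}"]) (auto simp: nested_pairs_def)

text \<open>The three parts correspond to the three choices in the last factor.\<close>

lemma nested_pairs_Suc:
  fixes n defines "f \<equiv> \<lambda>(I, J). (I, insert (Suc n) J)"
    and "g \<equiv> \<lambda>(I, J). (insert (Suc n) I, insert (Suc n) J)"
  shows "nested_pairs (Suc n) = nested_pairs n \<union> (f ` nested_pairs n \<union> g ` nested_pairs n)" (is ?A)
    and "nested_pairs n \<inter> (f ` nested_pairs n \<union> g ` nested_pairs n) = {}" (is ?B)
    and "f ` nested_pairs n \<inter> g ` nested_pairs n = {}" (is ?C)
    and "inj_on f (nested_pairs n)" (is ?D) and "inj_on g (nested_pairs n)" (is ?E)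
proof -
  have N: "Suc n \<notin> I \<and> Suc n \<notin> J" if "(I, J) \<in> nested_pairs n" for I J
    using that by (auto simp: nested_pairs_def)
  show ?B ?C by (auto simp: f_def g_def dest!: N)
  show ?D by (auto simp: f_def inj_on_def insert_ident dest!: N)
  show ?E by (auto simp: g_def inj_on_def insert_ident dest!: N)
  show ?A
  proof (intro subset_antisym subsetI)
    fix x assume "x \<in> nested_pairs (Suc n)"
    then obtain I J where x: "x = (I, J)" "I \<subseteq> J" "J \<subseteq> {1..Suc n}" by (auto simp: nested_pairs_def)
    let ?y = "(I - {Suc n}, J - {Suc n})"
    have y: "?y \<in> nested_pairs n" using x by (auto simp: nested_pairs_def atLeastAtMostSuc_conv)
    consider "Suc n \<notin> J" | "Suc n \<in> J" "Suc n \<notin> I" | "Suc n \<in> I" by blast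
    then have "x = ?y \<or> x = f ?y \<or> x = g ?y" using x by cases (auto simp: f_def g_def)
    then show "x \<in> nested_pairs n \<union> (f ` nested_pairs n \<union> g ` nested_pairs n)" using y by blast
  qed (auto simp: f_def g_def nested_pairs_def atLeastAtMostSuc_conv)
qed

context milnor_witt
begin

definition expansion_term :: "'a \<Rightarrow> nat \<Rightarrow> (nat \<Rightarrow> int) \<Rightarrow> (nat \<Rightarrow> 'a) \<Rightarrow> nat set \<times> nat set \<Rightarrow> _" where
  "expansion_term p n m u = (\<lambda>(I, J).
     eps_monomial p ((-1) ^ shuffle_exp n J * (\<Prod>i\<in>I. m i) * (\<Prod>k\<in>{1..n} - J. m k))
       (card I) (n - card J + card I) (map u (sorted_list_of_set J)))"

lemma map_sorted_list_F_star:
  fixes u :: "nat \<Rightarrow> 'a"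
  assumes "\<And>i. i \<in> {1..n} \<Longrightarrow> u i \<in> F_star" "J \<subseteq> {1..n}"
  shows "set (map u (sorted_list_of_set J)) \<subseteq> F_star"
proof -
  have "finite J" by (rule finite_subset[OF assms(2)]) simp
  then have "set (map u (sorted_list_of_set J)) = u ` J" by simp
  then show ?thesis using assms by auto
qed

lemma expansion_term_closed:
  assumes "p \<in> F_star" "\<And>i. i \<in> {1..n} \<Longrightarrow> u i \<in> F_star" "x \<in> nested_pairs n"
  shows "expansion_term p n m u x \<in> carrier R"
proof -
  obtain I J where x: "x = (I, J)" "J \<subseteq> {1..n}" using assms(3) by (auto simp: nested_pairs_def)
  show ?thesis
    unfolding expansion_term_def x(1) prod.case
    by (rule eps_monomial_closed[OF assms(1) map_sorted_list_F_star[OF assms(2) x(2)]])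
qed

text \<open>By induction on \<open>n\<close>, multiplying by the last factor on the right. For \<open>i \<in> I\<close> and for \<open>k \<notin> J\<close> the
  integers \<open>m\<^sub>i\<close> and \<open>m\<^sub>k\<close> enter the coefficient in the same way, as the multiplicity of a factor \<open>[\<pi>]\<close>.\<close>

lemma mw_sym_expansion:
  fixes m :: "nat \<Rightarrow> int"
  assumes F: "field F" and p: "p \<in> F_star" and "\<And>i. i \<in> {1..n} \<Longrightarrow> u i \<in> F_star"
  shows "mw_sym F (map (\<lambda>i. p [^]\<^bsub>F\<^esub> m i \<otimes>\<^bsub>F\<^esub> u i) [1..<n+1]) =
    (\<Oplus>x\<in>nested_pairs n. expansion_term p n m u x)"
  using assms(3)
proof (induction n)
  case 0
  have "nested_pairs 0 = {({}, {})}" by (auto simp: nested_pairs_def)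
  then show ?case
    by (simp add: expansion_term_def eps_monomial_def mw_sym_Nil shuffle_exp_def eps_1)
next
  case (Suc n)
  let ?a = "\<lambda>i. p [^]\<^bsub>F\<^esub> m i \<otimes>\<^bsub>F\<^esub> u i"
  have u: "u i \<in> F_star" if "i \<in> {1..Suc n}" for i using Suc.prems that .
  have a: "?a i \<in> F_star" if "i \<in> {1..Suc n}" for i
    using mult_F_star[OF sym_int_pow(1)[OF F p] u[OF that]] .
  have ul: "set (map u (sorted_list_of_set J)) \<subseteq> F_star" if "J \<subseteq> {1..Suc n}" for J
    by (rule map_sorted_list_F_star[OF u that])
  define f where "f = (\<lambda>(I, J). (I :: nat set, insert (Suc n) J))"
  define g where "g = (\<lambda>(I, J). (insert (Suc n) I, insert (Suc n) J))"
  note np = nested_pairs_Suc[of n, folded f_def g_def]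
  let ?E = "expansion_term p n m u" and ?E' = "expansion_term p (Suc n) m u"
  have clE: "?E x \<in> carrier R" if "x \<in> nested_pairs n" for x
    by (rule expansion_term_closed[OF p u that]) simp
  have clE': "?E' x \<in> carrier R" if "x \<in> nested_pairs (Suc n)" for x
    by (rule expansion_term_closed[OF p u that])
  have step: "?E x \<otimes> sym (?a (Suc n)) = ?E' x \<oplus> (?E' (f x) \<oplus> ?E' (g x))"
    if x: "x \<in> nested_pairs n" for x
  proof -
    obtain I J where IJ: "x = (I, J)" "I \<subseteq> J" "J \<subseteq> {1..n}" using x by (auto simp: nested_pairs_def)
    have fin: "finite I" "finite J" using IJ by (auto intro: finite_subset)
    have nI: "Suc n \<notin> I" "Suc n \<notin> J" using IJ by auto
    have le: "card J \<le> n" using card_mono[OF _ IJ(3)] by simp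
    have J': "J \<subseteq> {1..Suc n}" using IJ by auto
    have s1: "{1..Suc n} - J = insert (Suc n) ({1..n} - J)"
      and s2: "{1..Suc n} - insert (Suc n) J = {1..n} - J"
      using nI by auto
    have p1: "(\<Prod>k\<in>{1..Suc n} - J. m k) = m (Suc n) * (\<Prod>k\<in>{1..n} - J. m k)"
      unfolding s1 by (rule prod.insert) auto
    have p2: "(\<Prod>k\<in>insert (Suc n) I. m k) = m (Suc n) * (\<Prod>k\<in>I. m k)"
      using nI fin by simp
    let ?us = "map u (sorted_list_of_set J)"
    let ?c = "(-1) ^ shuffle_exp n J * (\<Prod>i\<in>I. m i) * (\<Prod>k\<in>{1..n} - J. m k)"
    have us': "map u (sorted_list_of_set (insert (Suc n) J)) = ?us @ [u (Suc n)]"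
      using sorted_list_of_set_insert_Suc[OF IJ(3)] by simp
    have E1: "?E' x = eps_monomial p (?c * m (Suc n) * (-1) ^ length ?us) (card I) (Suc (n - card J + card I)) ?us"
      unfolding IJ(1) expansion_term_def prod.case p1
      using le by (simp add: shuffle_exp_Suc[OF IJ(3)] power_add
          Suc_diff_le algebra_simps)
    have E2: "?E' (f x) = eps_monomial p ?c (card I) (n - card J + card I) (?us @ [u (Suc n)])"
      unfolding IJ(1) f_def expansion_term_def prod.case s2 shuffle_exp_insert_Suc[OF IJ(3)] us'
        card_insert_Suc[OF IJ(3)] by simp
    have E3: "?E' (g x) = eps_monomial p (?c * m (Suc n)) (Suc (card I)) (Suc (n - card J + card I)) (?us @ [u (Suc n)])"
      unfolding IJ(1) g_def expansion_term_def prod.case s2 p2 shuffle_exp_insert_Suc[OF IJ(3)] us'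
        card_insert_Suc[OF IJ(3)] using nI fin by (simp add: algebra_simps)
    have cl: "?E' x \<in> carrier R" "?E' (f x) \<in> carrier R" "?E' (g x) \<in> carrier R"
      using clE' np(1) x by blast+
    have "?E x \<otimes> sym (?a (Suc n)) = ?E' x \<oplus> ?E' (f x) \<oplus> ?E' (g x)"
      unfolding E1 E2 E3 using eps_monomial_sym_pow_mult[OF F p ul[OF J'] u[of "Suc n"]]
      by (simp add: IJ(1) expansion_term_def)
    then show ?thesis using cl by (simp add: a_assoc)
  qed
  have cl: "?E' x \<in> carrier R" "?E' (f x) \<in> carrier R" "?E' (g x) \<in> carrier R"
    if "x \<in> nested_pairs n" for x
    using clE' np(1) that by blast+
  have "set (map ?a [1..<n+1]) \<subseteq> F_star" using a by auto
  then have "mw_sym F (map ?a [1..<Suc n+1]) = mw_sym F (map ?a [1..<n+1]) \<otimes> sym (?a (Suc n))"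
    using mw_sym_snoc[OF _ a[of "Suc n"]] by simp
  also have "mw_sym F (map ?a [1..<n+1]) = (\<Oplus>x\<in>nested_pairs n. ?E x)"
    by (rule Suc.IH) (use u in auto)
  also have "\<dots> \<otimes> sym (?a (Suc n)) = (\<Oplus>x\<in>nested_pairs n. ?E x \<otimes> sym (?a (Suc n)))"
    by (rule finsum_ldistr[OF finite_nested_pairs sym_closed[OF a]]) (use clE in auto)
  also have "\<dots> = (\<Oplus>x\<in>nested_pairs n. ?E' x \<oplus> (?E' (f x) \<oplus> ?E' (g x)))"
    by (rule finsum_cong') (use step cl in auto)
  also have "\<dots> = (\<Oplus>x\<in>nested_pairs n. ?E' x) \<oplus> ((\<Oplus>x\<in>nested_pairs n. ?E' (f x)) \<oplus> (\<Oplus>x\<in>nested_pairs n. ?E' (g x)))"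
    by (subst finsum_addf, use cl in force, use cl in force)+ simp
  also have "(\<Oplus>x\<in>nested_pairs n. ?E' (f x)) = (\<Oplus>x\<in>f ` nested_pairs n. ?E' x)"
    by (rule finsum_reindex[symmetric, OF _ np(4)]) (use cl in auto)
  also have "(\<Oplus>x\<in>nested_pairs n. ?E' (g x)) = (\<Oplus>x\<in>g ` nested_pairs n. ?E' x)"
    by (rule finsum_reindex[symmetric, OF _ np(5)]) (use cl in auto)
  also have "(\<Oplus>x\<in>f ` nested_pairs n. ?E' x) \<oplus> (\<Oplus>x\<in>g ` nested_pairs n. ?E' x)
      = (\<Oplus>x\<in>f ` nested_pairs n \<union> g ` nested_pairs n. ?E' x)"
    by (rule finsum_Un_disjoint[symmetric, OF _ _ np(3)]) (use cl finite_nested_pairs in auto)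
  also have "(\<Oplus>x\<in>nested_pairs n. ?E' x) \<oplus> \<dots> = (\<Oplus>x\<in>nested_pairs (Suc n). ?E' x)"
    unfolding np(1)
    by (rule finsum_Un_disjoint[symmetric, OF _ _ np(2)]) (use cl finite_nested_pairs in auto)
  finally show ?case .
qed

end

section \<open>Discrete valuations\<close>

locale valued_field = field F for F :: "('a, 'b) ring_scheme" (structure) + 
  fixes v :: "'a \<Rightarrow> int"
  assumes valuation: "discrete_valuation F v"
begin

lemma valuation_mult:
  assumes "x \<in> carrier F - {\<zero>}" "y \<in> carrier F - {\<zero>}"
  shows "v (x \<otimes> y) = v x + v y"
  using valuation assms field_Units
  by (auto simp: discrete_valuation_def epi_def hom_def units_of_carrier units_of_mult)

lemma valuation_one: "v \<one> = 0"
  using valuation_mult[of \<one> \<one>] by simp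

lemma valuation_minus:
  assumes "x \<in> carrier F - {\<zero>}" shows "v (\<ominus> x) = v x"
proof -
  have m: "\<ominus> \<one> \<in> carrier F - {\<zero>}" by (simp add: add.inv_eq_1_iff)
  have "\<ominus> \<one> \<otimes> \<ominus> \<one> = \<one>" by (simp add: l_minus)
  then have "v (\<ominus> \<one>) = 0" using valuation_mult[OF m m] valuation_one by simp
  moreover have "\<ominus> x = \<ominus> \<one> \<otimes> x" using assms by (simp add: l_minus)
  ultimately show ?thesis using valuation_mult[OF m assms] by simp
qed

lemma valuation_add:
  assumes "x \<in> carrier F - {\<zero>}" "y \<in> carrier F - {\<zero>}" "x \<oplus> y \<noteq> \<zero>"
  shows "min (v x) (v y) \<le> v (x \<oplus> y)"
  using valuation assms field_Units by (auto simp: discrete_valuation_def)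

abbreviation VR where "VR \<equiv> valuation_ring F v"
abbreviation VI where "VI \<equiv> valuation_ideal F v"

lemma valuation_ring_simps [simp]:
  "monoid.mult VR = monoid.mult F" "one VR = one F" "ring.zero VR = ring.zero F" "ring.add VR = ring.add F"
  by (simp_all add: valuation_ring_def)

lemma carrier_VR: "carrier VR = {x \<in> carrier F. x = \<zero> \<or> 0 \<le> v x}"
  by (simp add: valuation_ring_def)

lemma cring_VR: "cring VR"
proof -
  have "subring {x \<in> carrier F. x = \<zero> \<or> 0 \<le> v x} F"
  proof (rule subringI)
    fix x y assume xy: "x \<in> {x \<in> carrier F. x = \<zero> \<or> 0 \<le> v x}" "y \<in> {x \<in> carrier F. x = \<zero> \<or> 0 \<le> v x}"
    then show "x \<otimes> y \<in> {x \<in> carrier F. x = \<zero> \<or> 0 \<le> v x}"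
      by (cases "x = \<zero> \<or> y = \<zero>") (auto simp: valuation_mult)
    show "x \<oplus> y \<in> {x \<in> carrier F. x = \<zero> \<or> 0 \<le> v x}"
      using xy valuation_add[of x y] by (cases "x = \<zero> \<or> y = \<zero>") auto
  next
    fix x assume x: "x \<in> {x \<in> carrier F. x = \<zero> \<or> 0 \<le> v x}"
    then show "\<ominus> x \<in> {x \<in> carrier F. x = \<zero> \<or> 0 \<le> v x}"
      by (cases "x = \<zero>") (auto simp: valuation_minus)
  qed (auto simp: valuation_one)
  then have "subcring {x \<in> carrier F. x = \<zero> \<or> 0 \<le> v x} F" by (rule subcringI')
  then show ?thesis
    unfolding valuation_ring_def by (subst (asm) subcring_iff) auto
qed

lemma primeideal_VI: "primeideal VI VR"
proof -
  interpret V: cring VR by (rule cring_VR)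
  show ?thesis
  proof (rule primeidealI)
    show "ideal VI VR"
    proof (rule idealI[OF V.ring_axioms])
      show "subgroup VI (add_monoid VR)"
      proof (rule V.add.subgroupI)
        show "VI \<subseteq> carrier VR" "VI \<noteq> {}"
          by (auto simp: valuation_ideal_def carrier_VR)
        fix x assume x: "x \<in> VI"
        then have xV: "x \<in> carrier VR" and nxV: "\<ominus> x \<in> carrier VR"
          by (cases "x = \<zero>"; auto simp: valuation_ideal_def carrier_VR valuation_minus)+
        have "\<ominus>\<^bsub>VR\<^esub> x = \<ominus> x"
          by (rule V.minus_equality[OF _ xV nxV]) (use x in \<open>auto simp: valuation_ideal_def l_neg\<close>)
        then show "\<ominus>\<^bsub>VR\<^esub> x \<in> VI"
          using x by (cases "x = \<zero>") (auto simp: valuation_ideal_def valuation_minus)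
      next
        fix x y assume "x \<in> VI" "y \<in> VI"
        then show "x \<oplus>\<^bsub>VR\<^esub> y \<in> VI"
          using valuation_add[of x y] by (cases "x = \<zero> \<or> y = \<zero> \<or> x \<oplus> y = \<zero>") (auto simp: valuation_ideal_def)
      qed
    next
      fix a x assume ax: "a \<in> VI" "x \<in> carrier VR"
      then show "x \<otimes>\<^bsub>VR\<^esub> a \<in> VI" "a \<otimes>\<^bsub>VR\<^esub> x \<in> VI"
        by (cases "a = \<zero> \<or> x = \<zero>"; auto simp: valuation_ideal_def carrier_VR valuation_mult)+
    qed
    show "cring VR" by (rule cring_VR)
    have "\<one> \<in> carrier VR" "\<one> \<notin> VI"
      by (auto simp: carrier_VR valuation_ideal_def valuation_one)
    then show "carrier VR \<noteq> VI" by blast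
    fix a b assume "a \<in> carrier VR" "b \<in> carrier VR" "a \<otimes>\<^bsub>VR\<^esub> b \<in> VI"
    then show "a \<in> VI \<or> b \<in> VI"
      by (cases "a = \<zero> \<or> b = \<zero>") (auto simp: valuation_ideal_def carrier_VR valuation_mult integral_iff)
  qed
qed

lemma domain_residue_field: "domain (residue_field F v)"
  unfolding residue_field_def by (rule primeideal.quotient_is_domain[OF primeideal_VI])

lemma Units_VR:
  assumes "u \<in> Units VR"
  shows "u \<in> carrier F - {\<zero>}" "u \<in> carrier VR" "v u = 0"
proof -
  obtain w where w: "u \<in> carrier VR" "w \<in> carrier VR" "u \<otimes> w = \<one>"
    using assms by (auto simp: Units_def)
  then have nz: "u \<in> carrier F - {\<zero>}" "w \<in> carrier F - {\<zero>}" by (auto simp: carrier_VR)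
  then have "v u + v w = 0" using valuation_mult w(3) valuation_one by metis
  moreover have "0 \<le> v u" "0 \<le> v w" using w nz by (auto simp: carrier_VR)
  ultimately show "v u = 0" by simp
qed (use assms in \<open>auto simp: Units_def carrier_VR\<close>)

lemma residue_class_unit:
  assumes "u \<in> Units VR"
  shows "residue_class F v u \<in> carrier (residue_field F v) - {\<zero>\<^bsub>residue_field F v\<^esub>}"
proof -
  interpret I: primeideal VI VR by (rule primeideal_VI)
  have "u \<notin> VI" using Units_VR[OF assms] by (auto simp: valuation_ideal_def)
  then have "VI +>\<^bsub>VR\<^esub> u \<noteq> VI" using I.a_rcos_self[of u] Units_VR[OF assms] by auto
  moreover have "VI +>\<^bsub>VR\<^esub> u \<in> carrier (VR Quot VI)"
    using ring_hom_closed[OF I.rcos_ring_hom Units_VR(2)[OF assms]] .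
  ultimately show ?thesis
    by (simp add: residue_class_def residue_field_def FactRing_def)
qed

lemma minus_one_Units_VR: "\<ominus> \<one> \<in> Units VR"
proof -
  have m: "\<ominus> \<one> \<in> carrier F - {\<zero>}" by (simp add: add.inv_eq_1_iff)
  have "\<ominus> \<one> \<in> carrier VR" by (simp add: carrier_VR valuation_minus valuation_one)
  moreover have "\<ominus> \<one> \<otimes> \<ominus> \<one> = \<one>" by (simp add: l_minus)
  ultimately show ?thesis by (auto simp: Units_def)
qed

lemma residue_class_minus_one:
  "residue_class F v (\<ominus> \<one>) = \<ominus>\<^bsub>residue_field F v\<^esub> \<one>\<^bsub>residue_field F v\<^esub>"
proof -
  interpret K: domain "residue_field F v" by (rule domain_residue_field)
  interpret I: primeideal VI VR by (rule primeideal_VI)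
  have hom: "residue_class F v \<in> ring_hom VR (residue_field F v)"
    using I.rcos_ring_hom by (simp add: residue_class_def[abs_def] residue_field_def)
  have c: "\<ominus> \<one> \<in> carrier VR" using Units_VR(2)[OF minus_one_Units_VR] .
  have one: "\<one> \<in> carrier VR" using carrier_VR valuation_one by auto
  have "residue_class F v (\<ominus> \<one>) \<oplus>\<^bsub>residue_field F v\<^esub> residue_class F v \<one> = residue_class F v \<zero>"
    using ring_hom_add[OF hom c one] by (simp add: l_neg)
  moreover have "residue_class F v \<one> = \<one>\<^bsub>residue_field F v\<^esub>"
    using ring_hom_one[OF hom] by simp
  moreover have "residue_class F v \<zero> = \<zero>\<^bsub>residue_field F v\<^esub>"
    using ring_hom_zero[OF hom] cring_VR K.ring_axioms by (simp add: cring_def)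
  ultimately show ?thesis
    using K.minus_equality[OF _ K.one_closed ring_hom_closed[OF hom c]] by metis
qed

end

section \<open>Applying the residue morphism\<close>

lemma (in abelian_monoid) finsum_partition:
  assumes "finite A" "finite B" "h ` A \<subseteq> B" "\<And>x. x \<in> A \<Longrightarrow> f x \<in> carrier G"
  shows "(\<Oplus>x\<in>A. f x) = (\<Oplus>b\<in>B. \<Oplus>x\<in>{x \<in> A. h x = b}. f x)"
proof -
  have "A = (\<Union>b\<in>B. {x \<in> A. h x = b})" using assms(3) by auto
  then have "(\<Oplus>x\<in>A. f x) = (\<Oplus>x\<in>(\<Union>b\<in>B. {x \<in> A. h x = b}). f x)" by simp
  also have "\<dots> = (\<Oplus>b\<in>B. \<Oplus>x\<in>{x \<in> A. h x = b}. f x)"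
    by (rule add.finprod_UN_disjoint[OF assms(2)])
      (use assms in \<open>auto simp: pairwise_def disjnt_def\<close>)
  finally show ?thesis .
qed

text \<open>What the computation uses of the residue morphism, with the valuation hidden: \<open>U\<close> stands for the
  units of the valuation ring and \<open>cls\<close> for reduction to the residue field.\<close>

locale residue_map = milnor_witt F R + K: milnor_witt \<kappa> K
  for F :: "('a, 'b) ring_scheme" and R (structure)
    and \<kappa> :: "('c, 'd) ring_scheme" and K +
  fixes \<pi> :: 'a and \<delta> and U :: "'a set" and cls :: "'a \<Rightarrow> 'c"
  assumes F_field: "field F" and \<pi>_F_star: "\<pi> \<in> F_star"
    and delta_hom: "\<delta> \<in> hom (add_monoid R) (add_monoid K)"
    and delta_eta: "x \<in> carrier R \<Longrightarrow> \<delta> (\<eta> \<otimes> x) = mw_eta \<kappa> \<otimes>\<^bsub>K\<^esub> \<delta> x"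
    and delta_pi_units: "set us \<subseteq> U \<Longrightarrow> \<delta> (mw_sym F (\<pi> # us)) = mw_sym \<kappa> (map cls us)"
    and delta_units: "set us \<subseteq> U \<Longrightarrow> \<delta> (mw_sym F us) = \<zero>\<^bsub>K\<^esub>"
    and U_F_star: "U \<subseteq> F_star" and cls_F_star: "cls ` U \<subseteq> K.F_star"
    and neg_one_U: "neg_one \<in> U" and cls_neg_one: "cls neg_one = K.neg_one"
begin

lemma delta_group_hom: "group_hom (add_monoid R) (add_monoid K) \<delta>"
  by (intro group_hom.intro group_hom_axioms.intro add.is_group K.add.is_group delta_hom)

lemma delta_closed [simp]: "x \<in> carrier R \<Longrightarrow> \<delta> x \<in> carrier K"
  using group_hom.hom_closed[OF delta_group_hom] by simp

lemma delta_add: "x \<in> carrier R \<Longrightarrow> y \<in> carrier R \<Longrightarrow> \<delta> (x \<oplus> y) = \<delta> x \<oplus>\<^bsub>K\<^esub> \<delta> y"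
  using group_hom.hom_mult[OF delta_group_hom] by simp

lemma delta_zero: "\<delta> \<zero> = \<zero>\<^bsub>K\<^esub>"
  using group_hom.hom_one[OF delta_group_hom] by simp

lemma delta_int_multiple: "x \<in> carrier R \<Longrightarrow> \<delta> ([(k::int)] \<cdot> x) = [k] \<cdot>\<^bsub>K\<^esub> \<delta> x"
  using group_hom.hom_int_pow[OF delta_group_hom, of x k] by (simp add: add_pow_def)

lemma delta_finsum:
  assumes "finite A" "\<And>x. x \<in> A \<Longrightarrow> f x \<in> carrier R"
  shows "\<delta> (\<Oplus>x\<in>A. f x) = (\<Oplus>\<^bsub>K\<^esub>x\<in>A. \<delta> (f x))"
  using assms
proof (induction A)
  case (insert a A)
  then show ?case
    by (simp add: Pi_def delta_add)
qed (simp add: delta_zero)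

lemma delta_eta_pow:
  "x \<in> carrier R \<Longrightarrow> \<delta> (\<eta> [^] (e::nat) \<otimes> x) = mw_eta \<kappa> [^]\<^bsub>K\<^esub> e \<otimes>\<^bsub>K\<^esub> \<delta> x"
proof (induction e arbitrary: x)
  case (Suc e)
  have "\<delta> (\<eta> [^] Suc e \<otimes> x) = \<delta> (\<eta> [^] e \<otimes> (\<eta> \<otimes> x))"
    using Suc.prems by (simp add: m_assoc)
  also have "\<dots> = mw_eta \<kappa> [^]\<^bsub>K\<^esub> e \<otimes>\<^bsub>K\<^esub> (mw_eta \<kappa> \<otimes>\<^bsub>K\<^esub> \<delta> x)"
    using Suc by (simp add: delta_eta)
  finally show ?case using Suc.prems by (simp add: K.m_assoc)
qed simp

text \<open>As \<open>\<delta>\<close> is additive and commutes with \<open>\<eta>\<close> only, it has to be checked that it commutes with the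
  coefficients \<open>c\<^sub>\<epsilon>\<close>; since \<open>h = 2 + \<eta>[-1]\<close>, this comes down to multiplication by \<open>\<eta>[-1]\<close>.\<close>

lemma delta_eps:
  assumes x: "x \<in> carrier R"
    and *: "\<delta> (\<eta> \<otimes> (sym neg_one \<otimes> x)) = mw_eta \<kappa> \<otimes>\<^bsub>K\<^esub> (K.sym K.neg_one \<otimes>\<^bsub>K\<^esub> \<delta> x)"
  shows "\<delta> (eps c \<otimes> x) = K.eps c \<otimes>\<^bsub>K\<^esub> \<delta> x"
proof -
  note cl = sym_closed[OF neg_one_F_star(1)] K.sym_closed[OF K.neg_one_F_star(1)]
  have h: "\<delta> (hyperbolic \<otimes> x) = K.hyperbolic \<otimes>\<^bsub>K\<^esub> \<delta> x"
  proof -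
    have "hyperbolic \<otimes> x = x \<oplus> x \<oplus> \<eta> \<otimes> (sym neg_one \<otimes> x)"
      unfolding hyperbolic_def using x cl by (simp add: l_distr m_assoc)
    moreover have "K.hyperbolic \<otimes>\<^bsub>K\<^esub> \<delta> x = \<delta> x \<oplus>\<^bsub>K\<^esub> \<delta> x \<oplus>\<^bsub>K\<^esub> mw_eta \<kappa> \<otimes>\<^bsub>K\<^esub> (K.sym K.neg_one \<otimes>\<^bsub>K\<^esub> \<delta> x)"
      unfolding K.hyperbolic_def using x cl by (simp add: K.l_distr K.m_assoc)
    ultimately show ?thesis using x cl * by (simp add: delta_add)
  qed
  have "eps c \<otimes> x = [(c div 2)] \<cdot> (hyperbolic \<otimes> x) \<oplus> [(c mod 2)] \<cdot> x"
    unfolding eps_def using x by (simp add: l_distr scalar_mult add_pow_ldistr_int)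
  moreover have "K.eps c \<otimes>\<^bsub>K\<^esub> \<delta> x = [(c div 2)] \<cdot>\<^bsub>K\<^esub> (K.hyperbolic \<otimes>\<^bsub>K\<^esub> \<delta> x) \<oplus>\<^bsub>K\<^esub> [(c mod 2)] \<cdot>\<^bsub>K\<^esub> \<delta> x"
    unfolding K.eps_def using x by (simp add: K.l_distr K.scalar_mult K.add_pow_ldistr_int)
  ultimately show ?thesis using x by (simp add: delta_add delta_int_multiple h)
qed

text \<open>The factor \<open>\<eta>\<close> in \<open>\<eta>[-1][\<pi>]\<close> allows the unit \<open>-1\<close> to be moved behind \<open>\<pi>\<close>, where \<open>\<delta>\<close> is known.\<close>

lemma delta_eps_pi_units:
  assumes "set us \<subseteq> U"
  shows "\<delta> (eps c \<otimes> mw_sym F (\<pi> # us)) = K.eps c \<otimes>\<^bsub>K\<^esub> mw_sym \<kappa> (map cls us)"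
proof -
  have us: "set us \<subseteq> F_star" using assms U_F_star by auto
  have nus: "set (neg_one # us) \<subseteq> U" using assms neg_one_U by auto
  note cl = sym_closed[OF neg_one_F_star(1)] sym_closed[OF \<pi>_F_star] mw_sym_closed[OF us]
  have "\<eta> \<otimes> (sym neg_one \<otimes> mw_sym F (\<pi> # us)) = \<eta> \<otimes> (sym neg_one \<otimes> sym \<pi>) \<otimes> mw_sym F us"
    unfolding mw_sym_Cons using cl by (simp add: m_assoc)
  also have "\<dots> = \<eta> \<otimes> mw_sym F (\<pi> # neg_one # us)"
    unfolding mw_sym_Cons eta_swap[OF neg_one_F_star(1) \<pi>_F_star] using cl by (simp add: m_assoc)
  finally have "\<delta> (\<eta> \<otimes> (sym neg_one \<otimes> mw_sym F (\<pi> # us))) =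
      mw_eta \<kappa> \<otimes>\<^bsub>K\<^esub> mw_sym \<kappa> (map cls (neg_one # us))"
    using cl delta_pi_units[OF nus] by (simp add: mw_sym_Cons delta_eta)
  then have "\<delta> (\<eta> \<otimes> (sym neg_one \<otimes> mw_sym F (\<pi> # us))) =
      mw_eta \<kappa> \<otimes>\<^bsub>K\<^esub> (K.sym K.neg_one \<otimes>\<^bsub>K\<^esub> \<delta> (mw_sym F (\<pi> # us)))"
    by (simp add: K.mw_sym_Cons cls_neg_one delta_pi_units[OF assms])
  then show ?thesis
    using delta_eps[of "mw_sym F (\<pi> # us)" c] mw_sym_closed[of "\<pi> # us"] us \<pi>_F_star
    by (simp add: delta_pi_units[OF assms])
qed

lemma delta_eps_units:
  assumes "set us \<subseteq> U"
  shows "\<delta> (eps c \<otimes> mw_sym F us) = \<zero>\<^bsub>K\<^esub>"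
proof -
  have us: "set us \<subseteq> F_star" using assms U_F_star by auto
  have nus: "set (neg_one # us) \<subseteq> U" using assms neg_one_U by auto
  note cl = sym_closed[OF neg_one_F_star(1)] K.sym_closed[OF K.neg_one_F_star(1)] mw_sym_closed[OF us]
  have "\<delta> (\<eta> \<otimes> (sym neg_one \<otimes> mw_sym F us)) = \<zero>\<^bsub>K\<^esub>"
    using delta_units[OF nus] cl by (simp add: delta_eta mw_sym_Cons)
  then show ?thesis
    using delta_eps[of "mw_sym F us" c] cl delta_units[OF assms] by simp
qed

lemma mw_sym_replicate_Suc:
  assumes "set us \<subseteq> F_star"
  shows "mw_sym F (replicate (Suc r) \<pi> @ us) = mw_sym F (\<pi> # replicate r neg_one @ us)"
proof (induction r)
  case (Suc r)
  have "set (replicate r neg_one @ us) \<subseteq> F_star"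
    by (rule eps_monomial_list[OF neg_one_F_star(1) assms])
  note cl = sym_closed[OF neg_one_F_star(1)] sym_closed[OF \<pi>_F_star] mw_sym_closed[OF this]
  have "mw_sym F (replicate (Suc (Suc r)) \<pi> @ us) = sym \<pi> \<otimes> mw_sym F (replicate (Suc r) \<pi> @ us)"
    by (simp add: mw_sym_Cons)
  also have "\<dots> = (sym \<pi> \<otimes> sym \<pi>) \<otimes> mw_sym F (replicate r neg_one @ us)"
    unfolding Suc mw_sym_Cons using cl by (simp add: m_assoc)
  also have "\<dots> = mw_sym F (\<pi> # replicate (Suc r) neg_one @ us)"
    unfolding sym_square[OF F_field \<pi>_F_star] using cl by (simp add: mw_sym_Cons m_assoc)
  finally show ?case .
qed simp

lemma delta_eps_monomial_Suc:
  assumes "set us \<subseteq> U"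
  shows "\<delta> (eps_monomial \<pi> c e (Suc r) us) = K.eps_monomial K.neg_one c e r (map cls us)"
proof -
  have us: "set us \<subseteq> F_star" using assms U_F_star by auto
  have l: "set (replicate r neg_one @ us) \<subseteq> U" using assms neg_one_U by (auto simp: set_replicate_conv_if)
  then have l': "set (\<pi> # replicate r neg_one @ us) \<subseteq> F_star" using U_F_star \<pi>_F_star by auto
  have lk: "set (map cls (replicate r neg_one @ us)) \<subseteq> K.F_star"
    unfolding set_map by (rule subset_trans[OF image_mono[OF l] cls_F_star])
  have "eps_monomial \<pi> c e (Suc r) us = \<eta> [^] e \<otimes> (eps c \<otimes> mw_sym F (\<pi> # replicate r neg_one @ us))"
    unfolding eps_monomial_def mw_sym_replicate_Suc[OF us] eps_eta_pow using mw_sym_closed[OF l'] by (simp add: m_assoc)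
  then have "\<delta> (eps_monomial \<pi> c e (Suc r) us) =
      mw_eta \<kappa> [^]\<^bsub>K\<^esub> e \<otimes>\<^bsub>K\<^esub> (K.eps c \<otimes>\<^bsub>K\<^esub> mw_sym \<kappa> (map cls (replicate r neg_one @ us)))"
    using mw_sym_closed[OF l'] by (simp only: delta_eta_pow delta_eps_pi_units[OF l] eps_closed m_closed)
  also have "\<dots> = K.eps_monomial K.neg_one c e r (map cls us)"
    unfolding K.eps_monomial_def K.eps_eta_pow using K.mw_sym_closed[OF lk]
    by (simp add: K.m_assoc map_replicate cls_neg_one)
  finally show ?thesis .
qed

lemma delta_eps_monomial_0:
  assumes "set us \<subseteq> U"
  shows "\<delta> (eps_monomial \<pi> c 0 0 us) = \<zero>\<^bsub>K\<^esub>"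
  using delta_eps_units[OF assms] by (simp add: eps_monomial_def)

end

section \<open>The explicit formula\<close>

text \<open>The formula indexes the subsets of \<open>J\<close> by sets of positions in the increasing enumeration of \<open>J\<close>.\<close>

lemma bij_betw_nth_elem:
  assumes "finite J" shows "bij_betw (nth_elem J) {1..card J} J"
proof -
  have "bij_betw (\<lambda>i. i - 1) {1..card J} {..<card J}"
    by (rule bij_betwI[where g = Suc]) auto
  moreover have "bij_betw ((!) (sorted_list_of_set J)) {..<card J} J"
    using assms by (intro bij_betw_nth) auto
  ultimately have "bij_betw ((!) (sorted_list_of_set J) \<circ> (\<lambda>i. i - 1)) {1..card J} J"
    by (rule bij_betw_trans)
  then show ?thesis by (simp add: comp_def nth_elem_def[abs_def])
qed

lemma bij_betw_card_subsets:
  assumes "bij_betw g A B"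
  shows "bij_betw ((`) g) {I. I \<subseteq> A \<and> card I = p} {I. I \<subseteq> B \<and> card I = p}"
proof -
  have inj: "inj_on g A" and B: "B = g ` A" using assms by (auto simp: bij_betw_def)
  have "inj_on ((`) g) {I. I \<subseteq> A \<and> card I = p}"
    by (rule inj_on_subset[OF inj_on_image_Pow[OF inj]]) auto
  moreover have "(`) g ` {I. I \<subseteq> A \<and> card I = p} = {I. I \<subseteq> B \<and> card I = p}"
  proof (intro subset_antisym subsetI)
    fix I assume "I \<in> {I. I \<subseteq> B \<and> card I = p}"
    then obtain I' where "I' \<subseteq> A" "I = g ` I'" "card I = p" by (auto simp: B subset_image_iff)
    then show "I \<in> (`) g ` {I. I \<subseteq> A \<and> card I = p}"
      using card_image[OF inj_on_subset[OF inj]] by (intro image_eqI[of _ _ I']) auto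
  qed (use inj in \<open>auto simp: B card_image inj_on_subset\<close>)
  ultimately show ?thesis by (simp add: bij_betw_def)
qed

context residue_map
begin

lemma delta_mw_sym:
  fixes m :: "nat \<Rightarrow> int" and u :: "nat \<Rightarrow> 'a"
  assumes n: "n \<ge> 1" and u: "\<And>i. i \<in> {1..n} \<Longrightarrow> u i \<in> U"
  shows "\<delta> (mw_sym F (map (\<lambda>i. \<pi> [^]\<^bsub>F\<^esub> m i \<otimes>\<^bsub>F\<^esub> u i) [1..<n+1])) =
      (\<Oplus>\<^bsub>K\<^esub> l\<in>{0..n-1}. \<Oplus>\<^bsub>K\<^esub> J\<in>{J. J \<subseteq> {1..n} \<and> card J = l}.
         mw_int_eps \<kappa>
           ((-1) ^ (\<Sum>i=1..l. n - l + i - nth_elem J i) * (\<Prod>k\<in>{1..n} - J. m k))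
         \<otimes>\<^bsub>K\<^esub> mw_sym_minus_one \<kappa> (n - 1 - l) (\<lambda>j. cls (u j)) J)
      \<oplus>\<^bsub>K\<^esub>
      (\<Oplus>\<^bsub>K\<^esub> p\<in>{1..n}. \<Oplus>\<^bsub>K\<^esub> l\<in>{p..n}. \<Oplus>\<^bsub>K\<^esub> J\<in>{J. J \<subseteq> {1..n} \<and> card J = l}.
         (\<Oplus>\<^bsub>K\<^esub> I\<in>{I. I \<subseteq> {1..l} \<and> card I = p}.
            [chi_odd ((\<Prod>i\<in>I. m (nth_elem J i)) * (\<Prod>k\<in>{1..n} - J. m k))] \<cdot>\<^bsub>K\<^esub>
              (mw_eta \<kappa> [^]\<^bsub>K\<^esub> p))
         \<otimes>\<^bsub>K\<^esub> mw_sym_minus_one \<kappa> (n - 1 + p - l) (\<lambda>j. cls (u j)) J)"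
    (is "_ = ?eta_free_part \<oplus>\<^bsub>K\<^esub> ?eta_part")
proof -
  let ?u = "\<lambda>j. cls (u j)"
  let ?Q = "\<lambda>J. \<Prod>k\<in>{1..n} - J. m k"
  define D where "D = (\<lambda>(I, J). K.eps_monomial K.neg_one
      ((-1) ^ shuffle_exp n J * (\<Prod>i\<in>I. m i) * ?Q J) (card I) (n - card J + card I - 1)
      (map ?u (sorted_list_of_set J)))"
  define N0 N1 where "N0 = (\<lambda>J. ({} :: nat set, J)) ` (Pow {1..n} - {{1..n}})"
    and "N1 = {(I, J). I \<noteq> {} \<and> I \<subseteq> J \<and> J \<subseteq> {1..n}}"
  have np: "nested_pairs n = insert ({}, {1..n}) (N0 \<union> N1)"
    by (auto simp: nested_pairs_def N0_def N1_def)
  have fin: "finite N0" "finite N1"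
    using finite_nested_pairs[of n] by (simp_all add: np)
  have disj: "({}, {1..n}) \<notin> N0 \<union> N1" "N0 \<inter> N1 = {}" by (auto simp: N0_def N1_def)
  have uU: "set (map u (sorted_list_of_set J)) \<subseteq> U" if "J \<subseteq> {1..n}" for J
  proof -
    have "finite J" by (rule finite_subset[OF that]) simp
    then have "set (map u (sorted_list_of_set J)) = u ` J" by simp
    then show ?thesis using that u by auto
  qed
  have uF: "u i \<in> F_star" if "i \<in> {1..n}" for i using u[OF that] U_F_star by blast
  have uK: "set (map ?u (sorted_list_of_set J)) \<subseteq> K.F_star" if "J \<subseteq> {1..n}" for J
  proof -
    have "set (map ?u (sorted_list_of_set J)) = cls ` set (map u (sorted_list_of_set J))"
      by (simp add: image_image)
    then show ?thesis using image_mono[OF uU[OF that], of cls] cls_F_star by simp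
  qed
  have clD: "D x \<in> carrier K" if "x \<in> nested_pairs n" for x
  proof -
    obtain I J where x: "x = (I, J)" "J \<subseteq> {1..n}" using \<open>x \<in> nested_pairs n\<close> by (auto simp: nested_pairs_def)
    show ?thesis
      unfolding D_def x(1) prod.case by (rule K.eps_monomial_closed[OF K.neg_one_F_star(1) uK[OF x(2)]])
  qed
  have clS: "mw_sym_minus_one \<kappa> r ?u J \<in> carrier K" if "J \<subseteq> {1..n}" for r J
    unfolding mw_sym_minus_one_def
    by (rule K.mw_sym_closed[OF K.eps_monomial_list[OF K.neg_one_F_star(1) uK[OF that]]])
  have delta_D: "\<delta> (expansion_term \<pi> n m u x) = D x" if "x \<in> N0 \<union> N1" for x
  proof -
    have "x \<in> nested_pairs n" using that np by blast
    then obtain I J where IJ: "x = (I, J)" "I \<subseteq> J" "J \<subseteq> {1..n}" by (auto simp: nested_pairs_def)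
    have finJ: "finite J" by (rule finite_subset[OF IJ(3)]) simp
    \<comment> \<open>The exponent of \<open>[\<pi>]\<close> is positive, so one factor can be given up to the residue.\<close>
    have "n - card J + card I \<noteq> 0"
    proof
      assume "n - card J + card I = 0"
      then have "I = {}" "n \<le> card J" using finite_subset[OF IJ(2) finJ] by auto
      then have "J = {1..n}" using card_seteq[OF _ IJ(3)] by simp
      then show False using that disj(1) IJ(1) \<open>I = {}\<close> by blast
    qed
    then obtain r where r: "n - card J + card I = Suc r" using not0_implies_Suc by blast
    show ?thesis
      unfolding IJ(1) expansion_term_def D_def prod.case r delta_eps_monomial_Suc[OF uU[OF IJ(3)]]
      by (simp add: comp_def)
  qed
  \<comment> \<open>The only term without a factor \<open>[\<pi>]\<close>.\<close>
  have delta_0: "\<delta> (expansion_term \<pi> n m u ({}, {1..n})) = \<zero>\<^bsub>K\<^esub>"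
    using delta_eps_monomial_0[OF uU[of "{1..n}"]] by (simp add: expansion_term_def)
  have "\<delta> (mw_sym F (map (\<lambda>i. \<pi> [^]\<^bsub>F\<^esub> m i \<otimes>\<^bsub>F\<^esub> u i) [1..<n+1])) =
      \<delta> (\<Oplus>x\<in>nested_pairs n. expansion_term \<pi> n m u x)"
    using mw_sym_expansion[OF F_field \<pi>_F_star uF] by simp
  also have "\<dots> = (\<Oplus>\<^bsub>K\<^esub>x\<in>nested_pairs n. \<delta> (expansion_term \<pi> n m u x))"
    by (rule delta_finsum[OF finite_nested_pairs expansion_term_closed[OF \<pi>_F_star uF]])
  also have "\<dots> = (\<Oplus>\<^bsub>K\<^esub>x\<in>N0 \<union> N1. \<delta> (expansion_term \<pi> n m u x))"
    unfolding np
    by (subst K.finsum_insert)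
      (use fin disj delta_0 delta_D clD np in \<open>auto simp: Pi_def intro!: K.l_zero K.finsum_closed\<close>)
  also have "\<dots> = (\<Oplus>\<^bsub>K\<^esub>x\<in>N0 \<union> N1. D x)"
    by (rule K.finsum_cong') (use delta_D clD np in auto)
  also have "\<dots> = (\<Oplus>\<^bsub>K\<^esub>x\<in>N0. D x) \<oplus>\<^bsub>K\<^esub> (\<Oplus>\<^bsub>K\<^esub>x\<in>N1. D x)"
    by (rule K.finsum_Un_disjoint[OF fin disj(2)]) (use clD np in auto)
  also have "(\<Oplus>\<^bsub>K\<^esub>x\<in>N0. D x) = ?eta_free_part"
  proof -
    let ?A = "Pow {1..n} - {{1..n}}"
    have card_less: "card J \<le> n - 1" if "J \<in> ?A" for J
    proof -
      have "J \<subset> {1..n}" using that by auto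
      then have "card J < n" using psubset_card_mono[of "{1..n}" J] by simp
      then show ?thesis by simp
    qed
    then have card_A: "card ` ?A \<subseteq> {0..n-1}" by (intro image_subsetI) simp
    have "(\<Oplus>\<^bsub>K\<^esub>x\<in>N0. D x) = (\<Oplus>\<^bsub>K\<^esub>J\<in>?A. D ({}, J))"
      unfolding N0_def by (rule K.finsum_reindex) (use clD in \<open>auto simp: np N0_def inj_on_def\<close>)
    also have "\<dots> = (\<Oplus>\<^bsub>K\<^esub>l\<in>{0..n-1}. \<Oplus>\<^bsub>K\<^esub>J\<in>{J \<in> ?A. card J = l}. D ({}, J))"
      by (rule K.finsum_partition[OF _ _ card_A]) (use clD in \<open>auto simp: np N0_def\<close>)
    also have "\<dots> = ?eta_free_part"
    proof (rule K.finsum_cong'[OF refl])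
      fix l assume l: "l \<in> {0..n-1}"
      have A: "{J \<in> ?A. card J = l} = {J. J \<subseteq> {1..n} \<and> card J = l}" using l n by auto
      show "(\<Oplus>\<^bsub>K\<^esub>J\<in>{J \<in> ?A. card J = l}. D ({}, J)) =
          (\<Oplus>\<^bsub>K\<^esub> J\<in>{J. J \<subseteq> {1..n} \<and> card J = l}.
         mw_int_eps \<kappa> ((-1) ^ (\<Sum>i=1..l. n - l + i - nth_elem J i) * ?Q J)
         \<otimes>\<^bsub>K\<^esub> mw_sym_minus_one \<kappa> (n - 1 - l) ?u J)"
        unfolding A
      proof (rule K.finsum_cong'[OF refl])
        fix J assume J: "J \<in> {J. J \<subseteq> {1..n} \<and> card J = l}"
        have "n - card J - 1 = n - 1 - l" using J by auto
        then show "D ({}, J) = mw_int_eps \<kappa> ((-1) ^ (\<Sum>i=1..l. n - l + i - nth_elem J i) * ?Q J)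
         \<otimes>\<^bsub>K\<^esub> mw_sym_minus_one \<kappa> (n - 1 - l) ?u J"
          using J by (simp add: D_def K.eps_monomial_def K.mw_int_eps_eq mw_sym_minus_one_def shuffle_exp_def)
      qed (use clS in \<open>auto simp: K.mw_int_eps_eq\<close>)
    qed (use clS in \<open>auto simp: K.mw_int_eps_eq intro!: K.finsum_closed\<close>)
    finally show ?thesis .
  qed
  also have "(\<Oplus>\<^bsub>K\<^esub>x\<in>N1. D x) = ?eta_part"
  proof -
    have N1: "card I \<in> {1..n}" "card J \<in> {card I..n}" if "(I, J) \<in> N1" for I J
    proof -
      have IJ: "I \<noteq> {}" "I \<subseteq> J" "J \<subseteq> {1..n}" using that by (auto simp: N1_def)
      have finJ: "finite J" by (rule finite_subset[OF IJ(3)]) simp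
      have "card I \<le> card J" using card_mono[OF finJ IJ(2)] .
      moreover have "card J \<le> n" using card_mono[OF _ IJ(3)] by simp
      moreover have "card I \<noteq> 0" using IJ finite_subset[OF IJ(2) finJ] by simp
      ultimately show "card I \<in> {1..n}" "card J \<in> {card I..n}" by auto
    qed
    let ?N = "\<lambda>p. {x \<in> N1. card (fst x) = p}"
    let ?NN = "\<lambda>p l. {x \<in> ?N p. card (snd x) = l}"
    let ?NNN = "\<lambda>p l J. {x \<in> ?NN p l. snd x = J}"
    have cl1: "D x \<in> carrier K" if "x \<in> N1" for x using that clD np by blast
    have "(\<Oplus>\<^bsub>K\<^esub>x\<in>N1. D x) = (\<Oplus>\<^bsub>K\<^esub>p\<in>{1..n}. \<Oplus>\<^bsub>K\<^esub>x\<in>?N p. D x)"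
      by (rule K.finsum_partition) (use fin N1 cl1 in \<open>auto simp: image_subset_iff\<close>)
    also have "\<dots> = ?eta_part"
    proof (rule K.finsum_cong'[OF refl])
      fix p assume p: "p \<in> {1..n}"
      have "(\<Oplus>\<^bsub>K\<^esub>x\<in>?N p. D x) = (\<Oplus>\<^bsub>K\<^esub>l\<in>{p..n}. \<Oplus>\<^bsub>K\<^esub>x\<in>?NN p l. D x)"
        by (rule K.finsum_partition) (use fin N1 cl1 in \<open>auto simp: image_subset_iff\<close>)
      also have "\<dots> = (\<Oplus>\<^bsub>K\<^esub> l\<in>{p..n}. \<Oplus>\<^bsub>K\<^esub> J\<in>{J. J \<subseteq> {1..n} \<and> card J = l}.
         (\<Oplus>\<^bsub>K\<^esub> I\<in>{I. I \<subseteq> {1..l} \<and> card I = p}.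
            [chi_odd ((\<Prod>i\<in>I. m (nth_elem J i)) * ?Q J)] \<cdot>\<^bsub>K\<^esub> (mw_eta \<kappa> [^]\<^bsub>K\<^esub> p))
         \<otimes>\<^bsub>K\<^esub> mw_sym_minus_one \<kappa> (n - 1 + p - l) ?u J)"
      proof (rule K.finsum_cong'[OF refl])
        fix l assume l: "l \<in> {p..n}"
        have "(\<Oplus>\<^bsub>K\<^esub>x\<in>?NN p l. D x) = (\<Oplus>\<^bsub>K\<^esub>J\<in>{J. J \<subseteq> {1..n} \<and> card J = l}. \<Oplus>\<^bsub>K\<^esub>x\<in>?NNN p l J. D x)"
          by (rule K.finsum_partition) (use fin cl1 in \<open>auto simp: image_subset_iff N1_def\<close>)
        also have "\<dots> = (\<Oplus>\<^bsub>K\<^esub> J\<in>{J. J \<subseteq> {1..n} \<and> card J = l}.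
         (\<Oplus>\<^bsub>K\<^esub> I\<in>{I. I \<subseteq> {1..l} \<and> card I = p}.
            [chi_odd ((\<Prod>i\<in>I. m (nth_elem J i)) * ?Q J)] \<cdot>\<^bsub>K\<^esub> (mw_eta \<kappa> [^]\<^bsub>K\<^esub> p))
         \<otimes>\<^bsub>K\<^esub> mw_sym_minus_one \<kappa> (n - 1 + p - l) ?u J)"
        proof (rule K.finsum_cong'[OF refl])
          fix J assume J: "J \<in> {J. J \<subseteq> {1..n} \<and> card J = l}"
          let ?A = "{I. I \<subseteq> {1..l} \<and> card I = p}"
          let ?S = "mw_sym_minus_one \<kappa> (n - 1 + p - l) ?u J"
          have finJ: "finite J" by (rule finite_subset[of _ "{1..n}"]) (use J in auto)
          have J1: "J \<subseteq> {1..n}" "card J = l" using J by auto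
          have bij: "bij_betw (nth_elem J) {1..l} J" using bij_betw_nth_elem[OF finJ] J1 by simp
          note bijS = bij_betw_card_subsets[OF bij, of p]
          have set: "?NNN p l J = (\<lambda>I. (nth_elem J ` I, J)) ` ?A"
          proof -
            have "?NNN p l J = (\<lambda>I. (I, J)) ` {I. I \<subseteq> J \<and> card I = p}"
              using J1 p by (auto simp: N1_def)
            also have "{I. I \<subseteq> J \<and> card I = p} = (`) (nth_elem J) ` ?A"
              using bijS by (simp add: bij_betw_def)
            finally show ?thesis by (simp add: image_image)
          qed
          have inj: "inj_on (\<lambda>I. (nth_elem J ` I, J)) ?A"
            using bijS by (auto simp: bij_betw_def inj_on_def)
          have clA: "D (nth_elem J ` I, J) \<in> carrier K" if "I \<in> ?A" for I
            by (rule cl1) (use that set in blast)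
          have entry: "D (nth_elem J ` I, J) =
              [chi_odd ((\<Prod>i\<in>I. m (nth_elem J i)) * ?Q J)] \<cdot>\<^bsub>K\<^esub> (mw_eta \<kappa> [^]\<^bsub>K\<^esub> p) \<otimes>\<^bsub>K\<^esub> ?S"
            if I: "I \<in> ?A" for I
          proof -
            have injI: "inj_on (nth_elem J) I"
              using bij I by (auto simp: bij_betw_def intro: inj_on_subset)
            have cI: "card (nth_elem J ` I) = p" using card_image[OF injI] I by simp
            have pr: "(\<Prod>i\<in>nth_elem J ` I. m i) = (\<Prod>i\<in>I. m (nth_elem J i))"
              using prod.reindex[OF injI, of m] by (simp add: comp_def)
            have ex: "n - l + p - 1 = n - 1 + p - l" using l p by auto
            have chi: "chi_odd ((-1) ^ shuffle_exp n J * (\<Prod>i\<in>I. m (nth_elem J i)) * ?Q J) =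
                chi_odd ((\<Prod>i\<in>I. m (nth_elem J i)) * ?Q J)"
              by (simp add: chi_odd_def)
            have "p > 0" using p by simp
            then show ?thesis
              unfolding D_def prod.case K.eps_monomial_def cI pr J1(2) ex mw_sym_minus_one_def
              by (simp only: K.eps_eta_pow_odd chi)
          qed
          have "(\<Oplus>\<^bsub>K\<^esub>x\<in>?NNN p l J. D x) = (\<Oplus>\<^bsub>K\<^esub>I\<in>?A. D (nth_elem J ` I, J))"
            unfolding set by (rule K.finsum_reindex[OF _ inj]) (use clA in auto)
          also have "\<dots> = (\<Oplus>\<^bsub>K\<^esub>I\<in>?A.
              [chi_odd ((\<Prod>i\<in>I. m (nth_elem J i)) * ?Q J)] \<cdot>\<^bsub>K\<^esub> (mw_eta \<kappa> [^]\<^bsub>K\<^esub> p) \<otimes>\<^bsub>K\<^esub> ?S)"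
            by (rule K.finsum_cong') (use entry clS[OF J1(1)] in auto)
          also have "\<dots> = (\<Oplus>\<^bsub>K\<^esub>I\<in>?A.
              [chi_odd ((\<Prod>i\<in>I. m (nth_elem J i)) * ?Q J)] \<cdot>\<^bsub>K\<^esub> (mw_eta \<kappa> [^]\<^bsub>K\<^esub> p)) \<otimes>\<^bsub>K\<^esub> ?S"
            by (rule K.finsum_ldistr[symmetric, OF _ clS[OF J1(1)]]) auto
          finally show "(\<Oplus>\<^bsub>K\<^esub>x\<in>?NNN p l J. D x) = (\<Oplus>\<^bsub>K\<^esub>I\<in>?A.
              [chi_odd ((\<Prod>i\<in>I. m (nth_elem J i)) * ?Q J)] \<cdot>\<^bsub>K\<^esub> (mw_eta \<kappa> [^]\<^bsub>K\<^esub> p)) \<otimes>\<^bsub>K\<^esub> ?S" .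
        qed (use clS in \<open>auto intro!: K.m_closed K.finsum_closed\<close>)
        finally show "(\<Oplus>\<^bsub>K\<^esub>x\<in>?NN p l. D x) = (\<Oplus>\<^bsub>K\<^esub> J\<in>{J. J \<subseteq> {1..n} \<and> card J = l}.
         (\<Oplus>\<^bsub>K\<^esub> I\<in>{I. I \<subseteq> {1..l} \<and> card I = p}.
            [chi_odd ((\<Prod>i\<in>I. m (nth_elem J i)) * ?Q J)] \<cdot>\<^bsub>K\<^esub> (mw_eta \<kappa> [^]\<^bsub>K\<^esub> p))
         \<otimes>\<^bsub>K\<^esub> mw_sym_minus_one \<kappa> (n - 1 + p - l) ?u J)" .
      qed (use clS in \<open>auto intro!: K.m_closed K.finsum_closed\<close>)
      finally show "(\<Oplus>\<^bsub>K\<^esub>x\<in>?N p. D x) = (\<Oplus>\<^bsub>K\<^esub> l\<in>{p..n}. \<Oplus>\<^bsub>K\<^esub> J\<in>{J. J \<subseteq> {1..n} \<and> card J = l}.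
         (\<Oplus>\<^bsub>K\<^esub> I\<in>{I. I \<subseteq> {1..l} \<and> card I = p}.
            [chi_odd ((\<Prod>i\<in>I. m (nth_elem J i)) * ?Q J)] \<cdot>\<^bsub>K\<^esub> (mw_eta \<kappa> [^]\<^bsub>K\<^esub> p))
         \<otimes>\<^bsub>K\<^esub> mw_sym_minus_one \<kappa> (n - 1 + p - l) ?u J)" .
    qed (use clS in \<open>auto intro!: K.m_closed K.finsum_closed\<close>)
    finally show ?thesis .
  qed
  finally show ?thesis .
qed

lemma delta_mw_angle:
  assumes u: "u \<in> U"
  shows "\<delta> (mw_angle F (\<pi> [^]\<^bsub>F\<^esub> (m::int) \<otimes>\<^bsub>F\<^esub> u) \<otimes> \<eta> [^] (e::nat)) =
    [chi_odd m] \<cdot>\<^bsub>K\<^esub> (mw_angle \<kappa> (cls u) \<otimes>\<^bsub>K\<^esub> mw_eta \<kappa> [^]\<^bsub>K\<^esub> Suc e)"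
proof -
  let ?a = "\<pi> [^]\<^bsub>F\<^esub> m \<otimes>\<^bsub>F\<^esub> u" and ?h = "mw_eta \<kappa>"
  have uF: "u \<in> F_star" and uK: "cls u \<in> K.F_star" using u U_F_star cls_F_star by auto
  have a: "?a \<in> F_star" by (rule mult_F_star[OF sym_int_pow(1)[OF F_field \<pi>_F_star] uF])
  note cl = sym_closed[OF a] sym_closed[OF \<pi>_F_star] sym_closed[OF uF] K.sym_closed[OF uK]
  have d1: "\<delta> (eps m \<otimes> sym \<pi>) = K.eps m"
    using delta_eps_pi_units[of "[]" m] cl by (simp add: mw_sym_Cons mw_sym_Nil K.mw_sym_Nil)
  have d2: "\<delta> (sym u) = \<zero>\<^bsub>K\<^esub>"
    using delta_units[of "[u]"] cl u by (simp add: mw_sym_Cons mw_sym_Nil)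
  have d3: "\<delta> (eps m \<otimes> sym \<pi> \<otimes> sym u) = K.eps m \<otimes>\<^bsub>K\<^esub> K.sym (cls u)"
    using delta_eps_pi_units[of "[u]" m] cl u
    by (simp add: mw_sym_Cons mw_sym_Nil K.mw_sym_Cons K.mw_sym_Nil m_assoc)
  have da: "\<delta> (sym ?a) = K.eps m \<oplus>\<^bsub>K\<^esub> ?h \<otimes>\<^bsub>K\<^esub> (K.eps m \<otimes>\<^bsub>K\<^esub> K.sym (cls u))"
    unfolding sym_mult[OF sym_int_pow(1)[OF F_field \<pi>_F_star] uF] sym_int_pow(2)[OF F_field \<pi>_F_star]
    using cl by (simp add: delta_add d1 d2 m_assoc[of \<eta>] delta_eta d3)
  have "mw_angle F ?a \<otimes> \<eta> [^] e = \<eta> [^] e \<otimes> (\<one> \<oplus> \<eta> \<otimes> sym ?a)"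
    unfolding mw_angle_eq[OF a, symmetric]
    by (rule eta_pow_commute[OF mw_angle_closed[OF a] eta_mw_angle[OF a], symmetric])
  then have "\<delta> (mw_angle F ?a \<otimes> \<eta> [^] e) = ?h [^]\<^bsub>K\<^esub> e \<otimes>\<^bsub>K\<^esub> (?h \<otimes>\<^bsub>K\<^esub> \<delta> (sym ?a))"
    using cl delta_units[of "[]"] by (simp add: delta_eta_pow delta_add delta_eta mw_sym_Nil)
  also have "?h \<otimes>\<^bsub>K\<^esub> \<delta> (sym ?a) = (?h \<otimes>\<^bsub>K\<^esub> K.eps m) \<oplus>\<^bsub>K\<^esub> ?h \<otimes>\<^bsub>K\<^esub> ((?h \<otimes>\<^bsub>K\<^esub> K.eps m) \<otimes>\<^bsub>K\<^esub> K.sym (cls u))"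
    unfolding da using cl by (simp add: K.r_distr K.m_assoc)
  also have "\<dots> = [chi_odd m] \<cdot>\<^bsub>K\<^esub> (?h \<otimes>\<^bsub>K\<^esub> mw_angle \<kappa> (cls u))"
    unfolding K.eps_eta(2) K.mw_angle_eq[OF uK] using cl
    by (simp add: K.add_pow_ldistr_int K.add_pow_rdistr_int K.r_distr K.add.int_pow_distrib)
  also have "?h [^]\<^bsub>K\<^esub> e \<otimes>\<^bsub>K\<^esub> \<dots> = [chi_odd m] \<cdot>\<^bsub>K\<^esub> (?h [^]\<^bsub>K\<^esub> Suc e \<otimes>\<^bsub>K\<^esub> mw_angle \<kappa> (cls u))"
    using K.mw_angle_closed[OF uK] by (simp add: K.add_pow_rdistr_int K.m_assoc)
  also have "?h [^]\<^bsub>K\<^esub> Suc e \<otimes>\<^bsub>K\<^esub> mw_angle \<kappa> (cls u) = mw_angle \<kappa> (cls u) \<otimes>\<^bsub>K\<^esub> ?h [^]\<^bsub>K\<^esub> Suc e"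
    by (rule K.eta_pow_commute[OF K.mw_angle_closed[OF uK] K.eta_mw_angle[OF uK]])
  finally show ?thesis .
qed

end

theorem theoremA10:
  fixes F :: "('a, 'b) ring_scheme"
    and v :: "'a \<Rightarrow> int"
    and \<pi> :: 'a
    and \<delta> :: "('a mw_gen word \<Rightarrow>\<^sub>0 int) set \<Rightarrow> ('a set mw_gen word \<Rightarrow>\<^sub>0 int) set"
  defines "\<kappa> \<equiv> residue_field F v"
    and "K \<equiv> KMW (residue_field F v)"
  assumes "perfect_field F"
    and "discrete_valuation F v"
    and "uniformizer F v \<pi>"
    and "is_residue_morphism F v \<pi> \<delta>"
  shows "(\<forall>(n::int) (m::int) u. n \<le> 0 \<longrightarrow> u \<in> Units (valuation_ring F v) \<longrightarrow>
      \<delta> (mw_angle F (\<pi> [^]\<^bsub>F\<^esub> m \<otimes>\<^bsub>F\<^esub> u) \<otimes>\<^bsub>KMW F\<^esub> mw_eta F [^]\<^bsub>KMW F\<^esub> (- n)) =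
      [chi_odd m] \<cdot>\<^bsub>K\<^esub>
        (mw_angle \<kappa> (residue_class F v u) \<otimes>\<^bsub>K\<^esub> mw_eta \<kappa> [^]\<^bsub>K\<^esub> (- n + 1)))
    \<and>
    (\<forall>(n::nat) (m::nat \<Rightarrow> int) (u::nat \<Rightarrow> 'a). n \<ge> 1 \<longrightarrow>
      (\<forall>i\<in>{1..n}. u i \<in> Units (valuation_ring F v)) \<longrightarrow>
      \<delta> (mw_sym F (map (\<lambda>i. \<pi> [^]\<^bsub>F\<^esub> m i \<otimes>\<^bsub>F\<^esub> u i) [1..<n+1])) =
      (\<Oplus>\<^bsub>K\<^esub> l\<in>{0..n-1}. \<Oplus>\<^bsub>K\<^esub> J\<in>{J. J \<subseteq> {1..n} \<and> card J = l}.
         mw_int_eps \<kappa>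
           ((-1) ^ (\<Sum>i=1..l. n - l + i - nth_elem J i) * (\<Prod>k\<in>{1..n} - J. m k))
         \<otimes>\<^bsub>K\<^esub> mw_sym_minus_one \<kappa> (n - 1 - l) (\<lambda>j. residue_class F v (u j)) J)
      \<oplus>\<^bsub>K\<^esub>
      (\<Oplus>\<^bsub>K\<^esub> p\<in>{1..n}. \<Oplus>\<^bsub>K\<^esub> l\<in>{p..n}. \<Oplus>\<^bsub>K\<^esub> J\<in>{J. J \<subseteq> {1..n} \<and> card J = l}.
         (\<Oplus>\<^bsub>K\<^esub> I\<in>{I. I \<subseteq> {1..l} \<and> card I = p}.
            [chi_odd ((\<Prod>i\<in>I. m (nth_elem J i)) * (\<Prod>k\<in>{1..n} - J. m k))] \<cdot>\<^bsub>K\<^esub>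
              (mw_eta \<kappa> [^]\<^bsub>K\<^esub> p))
         \<otimes>\<^bsub>K\<^esub> mw_sym_minus_one \<kappa> (n - 1 + p - l) (\<lambda>j. residue_class F v (u j)) J))"
proof -
  interpret FF: field F using assms(3) by (simp add: perfect_field_def)
  interpret V: valued_field F v
    by (intro valued_field.intro valued_field_axioms.intro FF.field_axioms assms(4))
  let ?U = "Units (valuation_ring F v)"
  have \<delta>: "\<delta> \<in> hom (add_monoid (KMW F)) (add_monoid K)"
    "\<And>x. x \<in> carrier (KMW F) \<Longrightarrow> \<delta> (mw_eta F \<otimes>\<^bsub>KMW F\<^esub> x) = mw_eta \<kappa> \<otimes>\<^bsub>K\<^esub> \<delta> x"
    "\<And>us. set us \<subseteq> ?U \<Longrightarrow> \<delta> (mw_sym F (\<pi> # us)) = mw_sym \<kappa> (map (residue_class F v) us)"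
    "\<And>us. set us \<subseteq> ?U \<Longrightarrow> \<delta> (mw_sym F us) = \<zero>\<^bsub>K\<^esub>"
    using assms(6) unfolding is_residue_morphism_def \<kappa>_def K_def by blast+
  have \<pi>: "\<pi> \<in> carrier F - {\<zero>\<^bsub>F\<^esub>}"
    using assms(5) FF.field_Units by (simp add: uniformizer_def)
  have mwF: "milnor_witt F (KMW F)" by (rule FF.milnor_witt_KMW)
  have mwK: "milnor_witt \<kappa> K"
    unfolding \<kappa>_def K_def by (rule domain.milnor_witt_KMW[OF V.domain_residue_field])
  interpret residue_map F "KMW F" \<kappa> K \<pi> \<delta> ?U "residue_class F v"
  proof (intro residue_map.intro residue_map_axioms.intro mwF mwK FF.field_axioms \<pi>)
    show "?U \<subseteq> carrier F - {\<zero>\<^bsub>F\<^esub>}" using V.Units_VR(1) by blast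
    show "residue_class F v ` ?U \<subseteq> carrier \<kappa> - {\<zero>\<^bsub>\<kappa>\<^esub>}"
      unfolding \<kappa>_def using V.residue_class_unit by blast
    show "\<ominus>\<^bsub>F\<^esub> \<one>\<^bsub>F\<^esub> \<in> ?U" by (rule V.minus_one_Units_VR)
    show "residue_class F v (\<ominus>\<^bsub>F\<^esub> \<one>\<^bsub>F\<^esub>) = \<ominus>\<^bsub>\<kappa>\<^esub> \<one>\<^bsub>\<kappa>\<^esub>"
      unfolding \<kappa>_def by (rule V.residue_class_minus_one)
  qed (fact \<delta>)+
  show ?thesis
  proof (intro conjI allI impI)
    fix n m :: int and u assume n: "n \<le> 0" and u: "u \<in> ?U"
    obtain e where e: "- n = int e" using n nonneg_int_cases[of "- n"] by auto
    then have e': "- n + 1 = int (Suc e)" by simp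
    show "\<delta> (mw_angle F (\<pi> [^]\<^bsub>F\<^esub> m \<otimes>\<^bsub>F\<^esub> u) \<otimes>\<^bsub>KMW F\<^esub> mw_eta F [^]\<^bsub>KMW F\<^esub> (- n)) =
      [chi_odd m] \<cdot>\<^bsub>K\<^esub>
        (mw_angle \<kappa> (residue_class F v u) \<otimes>\<^bsub>K\<^esub> mw_eta \<kappa> [^]\<^bsub>K\<^esub> (- n + 1))"
      unfolding e' unfolding e int_pow_int by (rule delta_mw_angle[OF u])
  next
    fix n :: nat and m u
    assume "n \<ge> 1" "\<forall>i\<in>{1..n}. u i \<in> ?U"
    then show "\<delta> (mw_sym F (map (\<lambda>i. \<pi> [^]\<^bsub>F\<^esub> m i \<otimes>\<^bsub>F\<^esub> u i) [1..<n+1])) =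
      (\<Oplus>\<^bsub>K\<^esub> l\<in>{0..n-1}. \<Oplus>\<^bsub>K\<^esub> J\<in>{J. J \<subseteq> {1..n} \<and> card J = l}.
         mw_int_eps \<kappa>
           ((-1) ^ (\<Sum>i=1..l. n - l + i - nth_elem J i) * (\<Prod>k\<in>{1..n} - J. m k))
         \<otimes>\<^bsub>K\<^esub> mw_sym_minus_one \<kappa> (n - 1 - l) (\<lambda>j. residue_class F v (u j)) J)
      \<oplus>\<^bsub>K\<^esub>
      (\<Oplus>\<^bsub>K\<^esub> p\<in>{1..n}. \<Oplus>\<^bsub>K\<^esub> l\<in>{p..n}. \<Oplus>\<^bsub>K\<^esub> J\<in>{J. J \<subseteq> {1..n} \<and> card J = l}.
         (\<Oplus>\<^bsub>K\<^esub> I\<in>{I. I \<subseteq> {1..l} \<and> card I = p}.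
            [chi_odd ((\<Prod>i\<in>I. m (nth_elem J i)) * (\<Prod>k\<in>{1..n} - J. m k))] \<cdot>\<^bsub>K\<^esub>
              (mw_eta \<kappa> [^]\<^bsub>K\<^esub> p))
         \<otimes>\<^bsub>K\<^esub> mw_sym_minus_one \<kappa> (n - 1 + p - l) (\<lambda>j. residue_class F v (u j)) J)"
      by (intro delta_mw_sym) auto
  qed
qed

end
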